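(* Let $(b_n)_{n\ge1}\in\ell^2$ with $\|(b_n)\|_2=1$ and $b_1\neq0$, let $f(z)=(b_1z,b_2z^2,b_3z^3,\dots)$ for $z\in\mathbb{D}$, and let $V=f(\mathbb{D})\subset\mathbb{B}_\infty$. Then $\mathcal{M}_V$ is isomorphic to $H^\infty$ if and only if \[ \sum_{n=1}^\infty n|b_n|^2<\infty. \]
   Context: $\mathbb{B}_\infty$ is the open unit ball of $\ell^2$. The Drury-Arveson space $\mathcal{H}_\infty$ is the reproducing kernel Hilbert space on $\mathbb{B}_\infty$ with kernel $k(x,y)=\frac{1}{1-\langle x,y\rangle}$, $k_y(x)=k(x,y)$. $\mathcal{H}_V=\overline{\operatorname{span}}\{k_y:y\in V\}\subset\mathcal{H}_\infty$, considered as a Hilbert space of functions on $V$, and $\mathcal{M}_V$ is its multiplier algebra (functions on $V$). Isomorphism means isomorphism of algebras. $H^\infty$ is the algebra of bounded analytic functions on the open unit disc $\mathbb{D}$. *)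

theory Defs
  imports "HOL-Analysis.Analysis" "HOL-Library.Function_Algebras"
begin

text \<open>
  A complex function on a set \<open>X\<close> is represented by a total function that vanishes outside \<open>X\<close>.
  This makes the functions on \<open>X\<close> closed under the pointwise operations of
  \<^theory>\<open>HOL-Library.Function_Algebras\<close>, and the unit of an algebra of functions on \<open>X\<close> is
  the indicator function of \<open>X\<close>.
\<close>

definition restrict0 :: "'a set \<Rightarrow> ('a \<Rightarrow> complex) \<Rightarrow> 'a \<Rightarrow> complex" where
  "restrict0 X f = (\<lambda>x. if x \<in> X then f x else 0)"

definition functions_on :: "'a set \<Rightarrow> ('a \<Rightarrow> complex) set" where
  "functions_on X = {f. \<forall>x. x \<notin> X \<longrightarrow> f x = 0}"

definition cscale :: "complex \<Rightarrow> ('a \<Rightarrow> complex) \<Rightarrow> 'a \<Rightarrow> complex" where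
  "cscale c f = (\<lambda>x. c * f x)"

global_interpretation cfun: vector_space "cscale :: complex \<Rightarrow> ('a \<Rightarrow> complex) \<Rightarrow> 'a \<Rightarrow> complex"
  defines cfun_subspace = cfun.subspace
    and cfun_span = cfun.span
  by unfold_locales (auto simp: cscale_def fun_eq_iff algebra_simps)


section \<open>Reproducing kernel Hilbert spaces\<close>

definition ip_norm :: "('f \<Rightarrow> 'f \<Rightarrow> complex) \<Rightarrow> 'f \<Rightarrow> real" where
  "ip_norm ip f = sqrt (Re (ip f f))"

text \<open>
  The inner product \<open>ip\<close> is linear in its first argument; its values are only relevant on \<open>H\<close>.
\<close>

locale hilbert_function_space =
  fixes X :: "'a set"
    and H :: "('a \<Rightarrow> complex) set"
    and ip :: "('a \<Rightarrow> complex) \<Rightarrow> ('a \<Rightarrow> complex) \<Rightarrow> complex"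
  assumes on_X: "H \<subseteq> functions_on X"
    and subspace: "cfun_subspace H"
    and ip_add: "\<lbrakk>f \<in> H; g \<in> H; h \<in> H\<rbrakk> \<Longrightarrow> ip (f + g) h = ip f h + ip g h"
    and ip_scale: "\<lbrakk>f \<in> H; h \<in> H\<rbrakk> \<Longrightarrow> ip (cscale c f) h = c * ip f h"
    and ip_cnj: "\<lbrakk>f \<in> H; h \<in> H\<rbrakk> \<Longrightarrow> ip h f = cnj (ip f h)"
    and ip_pos: "\<lbrakk>f \<in> H; f \<noteq> 0\<rbrakk> \<Longrightarrow> Re (ip f f) > 0"
    and complete:
      "\<lbrakk>\<And>n. s n \<in> H; \<And>e. e > 0 \<Longrightarrow> \<exists>N. \<forall>m\<ge>N. \<forall>n\<ge>N. ip_norm ip (s m - s n) < e\<rbrakk>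
        \<Longrightarrow> \<exists>l\<in>H. (\<lambda>n. ip_norm ip (s n - l)) \<longlonglongrightarrow> 0"

definition kernel_fun :: "'a set \<Rightarrow> ('a \<Rightarrow> 'a \<Rightarrow> complex) \<Rightarrow> 'a \<Rightarrow> 'a \<Rightarrow> complex" where
  "kernel_fun X k y = restrict0 X (\<lambda>x. k x y)"

text \<open>
  The set \<open>H\<close> and the values of \<open>ip\<close> on \<open>H\<close> are uniquely determined by \<open>X\<close> and \<open>k\<close>, and
  they exist whenever \<open>k\<close> is positive semidefinite on \<open>X\<close> (Moore--Aronszajn).
\<close>

locale rkhs = hilbert_function_space X H ip for X :: "'a set" and H ip +
  fixes k :: "'a \<Rightarrow> 'a \<Rightarrow> complex"
  assumes kernel_in: "y \<in> X \<Longrightarrow> kernel_fun X k y \<in> H"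
    and reproducing: "\<lbrakk>f \<in> H; y \<in> X\<rbrakk> \<Longrightarrow> ip f (kernel_fun X k y) = f y"

definition closed_span ::
  "('a \<Rightarrow> complex) set \<Rightarrow> (('a \<Rightarrow> complex) \<Rightarrow> ('a \<Rightarrow> complex) \<Rightarrow> complex)
    \<Rightarrow> ('a \<Rightarrow> complex) set \<Rightarrow> ('a \<Rightarrow> complex) set" where
  "closed_span H ip S = {g \<in> H. \<forall>e>0. \<exists>h \<in> cfun_span S. ip_norm ip (g - h) < e}"


section \<open>The Drury-Arveson space and its subspaces\<close>

text \<open>Coordinates are numbered from \<open>0\<close>: \<open>x n\<close> is the \<open>(n+1)\<close>-st coordinate of \<open>x\<close>.\<close>

definition ell2 :: "(nat \<Rightarrow> complex) set" where
  "ell2 = {x. summable (\<lambda>n. (cmod (x n))\<^sup>2)}"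

definition ell2_norm :: "(nat \<Rightarrow> complex) \<Rightarrow> real" where
  "ell2_norm x = sqrt (\<Sum>n. (cmod (x n))\<^sup>2)"

definition ell2_inner :: "(nat \<Rightarrow> complex) \<Rightarrow> (nat \<Rightarrow> complex) \<Rightarrow> complex" where
  "ell2_inner x y = (\<Sum>n. x n * cnj (y n))"

definition ell2_ball :: "(nat \<Rightarrow> complex) set" where
  "ell2_ball = {x \<in> ell2. ell2_norm x < 1}"

definition da_kernel :: "(nat \<Rightarrow> complex) \<Rightarrow> (nat \<Rightarrow> complex) \<Rightarrow> complex" where
  "da_kernel x y = 1 / (1 - ell2_inner x y)"

definition is_drury_arveson ::
  "((nat \<Rightarrow> complex) \<Rightarrow> complex) set
    \<Rightarrow> (((nat \<Rightarrow> complex) \<Rightarrow> complex) \<Rightarrow> ((nat \<Rightarrow> complex) \<Rightarrow> complex) \<Rightarrow> complex) \<Rightarrow> bool" where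
  "is_drury_arveson H ip \<longleftrightarrow> rkhs ell2_ball H ip da_kernel"

text \<open>
  For \<open>H\<close>, \<open>ip\<close> the Drury-Arveson space, the elements of \<open>\<H>\<^sub>V\<close> as functions on \<open>V\<close>.
\<close>

definition da_subspace ::
  "((nat \<Rightarrow> complex) \<Rightarrow> complex) set
    \<Rightarrow> (((nat \<Rightarrow> complex) \<Rightarrow> complex) \<Rightarrow> ((nat \<Rightarrow> complex) \<Rightarrow> complex) \<Rightarrow> complex)
    \<Rightarrow> (nat \<Rightarrow> complex) set \<Rightarrow> ((nat \<Rightarrow> complex) \<Rightarrow> complex) set" where
  "da_subspace H ip V = restrict0 V ` closed_span H ip (kernel_fun ell2_ball da_kernel ` V)"

definition multiplier_algebra :: "'a set \<Rightarrow> ('a \<Rightarrow> complex) set \<Rightarrow> ('a \<Rightarrow> complex) set" where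
  "multiplier_algebra X F = {\<phi> \<in> functions_on X. \<forall>f\<in>F. \<phi> * f \<in> F}"


section \<open>Bounded analytic functions and isomorphism of algebras\<close>

definition H_infty :: "(complex \<Rightarrow> complex) set" where
  "H_infty = {g \<in> functions_on (ball 0 1). g holomorphic_on ball 0 1 \<and> bounded (g ` ball 0 1)}"

text \<open>
  Isomorphism of complex algebras, purely algebraic. Both arguments are meant to be sets of
  functions closed under the pointwise operations; a unit is preserved automatically because
  \<open>T\<close> is bijective and multiplicative.
\<close>

definition algebra_isomorphic :: "('a \<Rightarrow> complex) set \<Rightarrow> ('b \<Rightarrow> complex) set \<Rightarrow> bool" where
  "algebra_isomorphic A B \<longleftrightarrow>
    (\<exists>T. bij_betw T A B \<and>
      (\<forall>f\<in>A. \<forall>g\<in>A. T (f + g) = T f + T g) \<and>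
      (\<forall>f\<in>A. \<forall>g\<in>A. T (f * g) = T f * T g) \<and>
      (\<forall>c. \<forall>f\<in>A. T (cscale c f) = cscale c (T f)))"

end

theory Submission
  imports Defs "HOL-Complex_Analysis.Complex_Analysis" "HOL-Library.Real_Mod"
begin

text \<open>
  Put \<open>a n = \<bar>b n\<bar>\<^sup>2\<close>; this is a probability distribution. At the points \<open>f z\<close> and \<open>f w\<close> of \<open>V\<close> the
  Drury-Arveson kernel is \<open>1 / (1 - (\<Sum>n. a n * (z * cnj w) ^ (n + 1)))\<close>, which expands as
  \<open>\<Sum>n. c n * (z * cnj w) ^ n\<close>. Here \<open>c\<close> is the renewal sequence of \<open>a\<close>: \<open>c n\<close> is the probability
  that a random walk from \<open>0\<close> visits \<open>n\<close> if its steps have length \<open>k + 1\<close> with probability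
  \<open>a k\<close>. Consequently composition with \<open>f\<close> identifies the functions on \<open>V\<close> in question with the
  power series \<open>\<Sum>n. u n * z ^ n\<close> that satisfy \<open>(\<Sum>n. \<bar>u n\<bar>\<^sup>2 / c n) < \<infinity>\<close>
  (\<open>pullback_power_series\<close> and \<open>power_series_in_closed_span\<close>), and the multiplier algebra with
  the multiplier algebra \<open>A\<close> of this weighted Hardy space. The theorem now follows from two
  equivalences with the statement that \<open>c\<close> is bounded below by a positive number.

  The first is that \<open>A\<close> is isomorphic to \<open>H_infty\<close> if and only if \<open>c\<close> is bounded below
  (\<open>weighted_hardy_multipliers_iso_iff\<close>). If it is, then the space is the Hardy space with an
  equivalent norm; bounded analytic functions multiply it by Parseval's identity, and multipliers
  are bounded by the uniform boundedness principle (\<open>multiplier_bounded\<close>). Conversely, an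
  isomorphism from \<open>H_infty\<close> to \<open>A\<close> must be composition with an analytic self-map of the disc,
  for the purely algebraic reason that \<open>z - \<alpha>\<close> divides \<open>g - g \<alpha>\<close>; looking at the coordinate
  function in \<open>A\<close> one finds a left inverse of this self-map that also maps the disc to itself.
  Hence \<open>A\<close> contains all of \<open>H_infty\<close> (\<open>H_infty_subset_of_isomorphic_algebra\<close>). But if \<open>c\<close> takes
  arbitrarily small values, then a gap series with summable coefficients lies in \<open>H_infty\<close> and
  not in the weighted Hardy space, hence not in \<open>A\<close>.

  The second is that \<open>c\<close> is bounded below if and only if the mean step length
  \<open>\<Sum>n. (n + 1) * a n\<close> is finite (\<open>renewal_bounded_below_iff\<close>). This follows from the identity
  \<open>(\<Sum>k\<le>n. t k * c (n - k)) = 1\<close>, where the \<open>t k\<close> are the tails of \<open>a\<close>, whose sum is the mean.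
\<close>

section \<open>Hilbert spaces of functions\<close>

lemma cscale_apply [simp]: "cscale c f x = c * f x"
  by (simp add: cscale_def)

lemma sum_fun_apply [simp]: "(\<Sum>i\<in>I. g i) x = (\<Sum>i\<in>I. g i x)"
  for g :: "'i \<Rightarrow> 'a \<Rightarrow> complex"
  by (induction I rule: infinite_finite_induct) auto

lemma diff_eq_add_cscale: "f - g = f + cscale (-1) g" for f g :: "'a \<Rightarrow> complex"
  by (auto simp: fun_eq_iff)

text \<open>
  Differences are treated as sums with a multiple by \<open>-1\<close>, so this multiple must not be
  rewritten to a negation, for which the axioms of the inner product say nothing.
\<close>

declare cfun.scale_minus_left [simp del]

lemma (in hilbert_function_space) zero_in: "0 \<in> H"
  using subspace by (rule cfun.subspace_0)

lemma (in hilbert_function_space) add_in: "f \<in> H \<Longrightarrow> g \<in> H \<Longrightarrow> f + g \<in> H"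
  using subspace by (rule cfun.subspace_add)

lemma (in hilbert_function_space) scale_in: "f \<in> H \<Longrightarrow> cscale c f \<in> H"
  using subspace by (rule cfun.subspace_scale)

lemma (in hilbert_function_space) diff_in: "f \<in> H \<Longrightarrow> g \<in> H \<Longrightarrow> f - g \<in> H"
  unfolding diff_eq_add_cscale by (intro add_in scale_in)

lemma (in hilbert_function_space) sum_in: "(\<And>i. i \<in> I \<Longrightarrow> f i \<in> H) \<Longrightarrow> (\<Sum>i\<in>I. f i) \<in> H"
  using subspace by (rule cfun.subspace_sum)

lemmas (in hilbert_function_space) H_closed = zero_in add_in scale_in diff_in sum_in

lemma (in hilbert_function_space) ip_diff:
  "f \<in> H \<Longrightarrow> g \<in> H \<Longrightarrow> h \<in> H \<Longrightarrow> ip (f - g) h = ip f h - ip g h"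
  unfolding diff_eq_add_cscale by (simp add: ip_add ip_scale H_closed)

lemma (in hilbert_function_space) ip_zero: "h \<in> H \<Longrightarrow> ip 0 h = 0"
  using ip_scale[of 0 h 0] zero_in by (simp add: cscale_def zero_fun_def)

lemma (in hilbert_function_space) ip_sum:
  "(\<And>i. i \<in> I \<Longrightarrow> f i \<in> H) \<Longrightarrow> h \<in> H \<Longrightarrow> ip (\<Sum>i\<in>I. f i) h = (\<Sum>i\<in>I. ip (f i) h)"
  by (induction I rule: infinite_finite_induct) (simp_all add: ip_zero ip_add H_closed)

lemma (in hilbert_function_space) ip_add_right:
  "f \<in> H \<Longrightarrow> g \<in> H \<Longrightarrow> h \<in> H \<Longrightarrow> ip h (f + g) = ip h f + ip h g"
  by (subst (1 2 3) ip_cnj) (simp_all add: ip_add H_closed)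

lemma (in hilbert_function_space) ip_diff_right:
  "f \<in> H \<Longrightarrow> g \<in> H \<Longrightarrow> h \<in> H \<Longrightarrow> ip h (f - g) = ip h f - ip h g"
  by (subst (1 2 3) ip_cnj) (simp_all add: ip_diff H_closed)

lemma (in hilbert_function_space) ip_scale_right:
  "f \<in> H \<Longrightarrow> h \<in> H \<Longrightarrow> ip h (cscale c f) = cnj c * ip h f"
  by (subst (1 2) ip_cnj) (simp_all add: ip_scale H_closed)

lemma (in hilbert_function_space) ip_sum_right:
  "(\<And>i. i \<in> I \<Longrightarrow> f i \<in> H) \<Longrightarrow> h \<in> H \<Longrightarrow> ip h (\<Sum>i\<in>I. f i) = (\<Sum>i\<in>I. ip h (f i))"
  by (induction I rule: infinite_finite_induct)
    (simp_all add: ip_zero ip_add_right H_closed ip_cnj[of 0 h])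

lemma (in hilbert_function_space) ip_norm_diff_self: "ip_norm ip (f - f) = 0"
proof -
  have "f - f = 0" by (auto simp: fun_eq_iff)
  then show ?thesis unfolding ip_norm_def by (simp only: ip_zero[OF zero_in]) simp
qed

lemma (in hilbert_function_space) Re_ip_nonneg: "f \<in> H \<Longrightarrow> 0 \<le> Re (ip f f)"
  using ip_pos[of f] ip_zero[OF zero_in] by (cases "f = 0") auto

lemma (in hilbert_function_space) ip_norm_sq: "f \<in> H \<Longrightarrow> (ip_norm ip f)\<^sup>2 = Re (ip f f)"
  by (simp add: ip_norm_def Re_ip_nonneg)

lemma (in hilbert_function_space) ip_norm_nonneg: "f \<in> H \<Longrightarrow> 0 \<le> ip_norm ip f"
  by (simp add: ip_norm_def Re_ip_nonneg)

lemma (in hilbert_function_space) ip_self: "f \<in> H \<Longrightarrow> ip f f = of_real ((ip_norm ip f)\<^sup>2)"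
proof -
  assume f: "f \<in> H"
  have "Im (ip f f) = 0" using ip_cnj[OF f f] by (metis cnj.simps(2) equal_neg_zero)
  then show ?thesis using f by (simp add: complex_eq_iff ip_norm_sq)
qed

lemma (in hilbert_function_space) ip_norm_cscale:
  assumes "f \<in> H" shows "ip_norm ip (cscale c f) = cmod c * ip_norm ip f"
proof -
  have "ip (cscale c f) (cscale c f) = of_real ((cmod c * ip_norm ip f)\<^sup>2)"
    using assms by (simp add: ip_scale ip_scale_right H_closed ip_self[OF assms] power_mult_distrib
        complex_norm_square del: of_real_power)
  then show ?thesis using ip_norm_nonneg[OF assms] by (simp add: ip_norm_def[of ip "cscale c f"] del: of_real_power)
qed

lemma (in hilbert_function_space) ip_norm_diff_sq:
  assumes "f \<in> H" "g \<in> H"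
  shows "(ip_norm ip (f - g))\<^sup>2 = (ip_norm ip f)\<^sup>2 - 2 * Re (ip f g) + (ip_norm ip g)\<^sup>2"
proof -
  have "Re (ip g f) = Re (ip f g)" using ip_cnj[of f g] assms by simp
  then show ?thesis using assms by (simp add: ip_norm_sq ip_diff ip_diff_right H_closed)
qed

lemma (in hilbert_function_space) Cauchy_Schwarz:
  assumes f: "f \<in> H" and g: "g \<in> H"
  shows "cmod (ip f g) \<le> ip_norm ip f * ip_norm ip g"
proof (cases "g = 0")
  case True
  then show ?thesis using ip_cnj[OF zero_in f] ip_zero[OF f] by (simp add: ip_norm_def ip_zero zero_in)
next
  case False
  define G where "G = (ip_norm ip g)\<^sup>2"
  have G: "G > 0" using ip_pos[OF g False] by (simp add: G_def ip_norm_sq g)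
  \<comment> \<open>\<open>cscale l g\<close> is the orthogonal projection of \<open>f\<close> to the line spanned by \<open>g\<close>.\<close>
  define l where "l = ip f g / of_real G"
  have "0 \<le> (ip_norm ip (f - cscale l g))\<^sup>2" by simp
  also have "\<dots> = (ip_norm ip f)\<^sup>2 - 2 * Re (ip f (cscale l g)) + (cmod l)\<^sup>2 * G"
    using f g by (simp add: ip_norm_diff_sq ip_norm_cscale H_closed G_def power_mult_distrib)
  also have "Re (ip f (cscale l g)) = (cmod (ip f g))\<^sup>2 / G"
    using f g by (simp add: ip_scale_right l_def cmod_power2 flip: power2_eq_square add_divide_distrib)
  also have "(cmod l)\<^sup>2 * G = (cmod (ip f g))\<^sup>2 / G"
    using G by (simp add: l_def norm_divide power_divide power2_eq_square)
  finally have "(cmod (ip f g))\<^sup>2 / G \<le> (ip_norm ip f)\<^sup>2" by simp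
  then have "(cmod (ip f g))\<^sup>2 \<le> (ip_norm ip f * ip_norm ip g)\<^sup>2"
    using G by (simp add: field_simps G_def power_mult_distrib)
  then show ?thesis by (rule power2_le_imp_le) (simp add: ip_norm_nonneg f g)
qed

lemma (in hilbert_function_space) ip_norm_triangle:
  assumes f: "f \<in> H" and g: "g \<in> H"
  shows "ip_norm ip (f + g) \<le> ip_norm ip f + ip_norm ip g"
proof -
  have "(ip_norm ip (f + g))\<^sup>2 = (ip_norm ip f)\<^sup>2 + 2 * Re (ip f g) + (ip_norm ip g)\<^sup>2"
    using f g ip_cnj[OF f g] by (simp add: ip_norm_sq ip_add ip_add_right H_closed)
  also have "Re (ip f g) \<le> ip_norm ip f * ip_norm ip g"
    using Cauchy_Schwarz[OF f g] complex_Re_le_cmod order_trans by blast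
  finally have "(ip_norm ip (f + g))\<^sup>2 \<le> (ip_norm ip f + ip_norm ip g)\<^sup>2"
    by (simp add: power2_sum)
  then show ?thesis by (rule power2_le_imp_le) (simp add: ip_norm_nonneg f g)
qed

lemma (in hilbert_function_space) ip_norm_minus_commute:
  assumes "f \<in> H" "g \<in> H" shows "ip_norm ip (f - g) = ip_norm ip (g - f)"
proof -
  have "f - g = cscale (-1) (g - f)" by (auto simp: fun_eq_iff)
  then have "ip_norm ip (f - g) = ip_norm ip (cscale (-1) (g - f))" by (rule arg_cong)
  also have "\<dots> = ip_norm ip (g - f)" using assms by (simp add: ip_norm_cscale H_closed)
  finally show ?thesis .
qed

lemma (in hilbert_function_space) ip_norm_diff_triangle:
  assumes "f \<in> H" "g \<in> H" "h \<in> H"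
  shows "ip_norm ip (f - h) \<le> ip_norm ip (f - g) + ip_norm ip (g - h)"
proof -
  have "f - h = (f - g) + (g - h)" by (auto simp: fun_eq_iff)
  then show ?thesis using ip_norm_triangle[of "f - g" "g - h"] assms by (simp add: H_closed)
qed

lemma (in hilbert_function_space) tendsto_ip:
  assumes s: "\<And>n. s n \<in> H" "l \<in> H" "(\<lambda>n. ip_norm ip (s n - l)) \<longlonglongrightarrow> 0"
    and t: "\<And>n. t n \<in> H" "m \<in> H" "(\<lambda>n. ip_norm ip (t n - m)) \<longlonglongrightarrow> 0"
  shows "(\<lambda>n. ip (s n) (t n)) \<longlonglongrightarrow> ip l m"
proof -
  have "(\<lambda>n. ip (s n) (t n) - ip l m) \<longlonglongrightarrow> 0"
  proof (rule Lim_null_comparison)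
    show "\<forall>\<^sub>F n in sequentially. cmod (ip (s n) (t n) - ip l m) \<le>
        ip_norm ip (s n - l) * ip_norm ip (t n - m) + ip_norm ip l * ip_norm ip (t n - m)
          + ip_norm ip (s n - l) * ip_norm ip m"
    proof (intro always_eventually allI)
      fix n
      have "ip (s n) (t n) - ip l m = ip (s n - l) (t n - m) + ip l (t n - m) + ip (s n - l) m"
        using s t by (simp add: ip_diff ip_diff_right H_closed)
      then show "cmod (ip (s n) (t n) - ip l m) \<le>
        ip_norm ip (s n - l) * ip_norm ip (t n - m) + ip_norm ip l * ip_norm ip (t n - m)
          + ip_norm ip (s n - l) * ip_norm ip m"
        using Cauchy_Schwarz[of "s n - l" "t n - m"] Cauchy_Schwarz[of l "t n - m"]
          Cauchy_Schwarz[of "s n - l" m] s(1,2) t(1,2)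
        by (metis diff_in norm_triangle_mono)
    qed
    show "(\<lambda>n. ip_norm ip (s n - l) * ip_norm ip (t n - m) + ip_norm ip l * ip_norm ip (t n - m)
          + ip_norm ip (s n - l) * ip_norm ip m) \<longlonglongrightarrow> 0"
      using tendsto_add[OF tendsto_add[OF tendsto_mult[OF s(3) t(3)] tendsto_mult[OF tendsto_const t(3)]]
          tendsto_mult[OF s(3) tendsto_const], of "ip_norm ip l" "ip_norm ip m"] by simp
  qed
  then show ?thesis by (simp add: LIM_zero_iff)
qed

lemma (in hilbert_function_space) tendsto_ip_left:
  assumes s: "\<And>n. s n \<in> H" "l \<in> H" "(\<lambda>n. ip_norm ip (s n - l)) \<longlonglongrightarrow> 0" and g: "g \<in> H"
  shows "(\<lambda>n. ip (s n) g) \<longlonglongrightarrow> ip l g"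
proof (rule tendsto_ip[OF s])
  show "(\<lambda>n. ip_norm ip (g - g)) \<longlonglongrightarrow> 0" unfolding ip_norm_diff_self by simp
qed (use g in auto)

lemma (in hilbert_function_space) ip_norm_orthogonal_sum:
  assumes E: "\<And>i. E i \<in> H" and on: "\<And>i j. ip (E i) (E j) = (if i = j then 1 else 0)" and fin: "finite I"
  shows "(ip_norm ip (\<Sum>i\<in>I. cscale (a i) (E i)))\<^sup>2 = (\<Sum>i\<in>I. (cmod (a i))\<^sup>2)"
proof -
  have "ip (\<Sum>i\<in>I. cscale (a i) (E i)) (\<Sum>i\<in>I. cscale (a i) (E i))
      = (\<Sum>i\<in>I. ip (cscale (a i) (E i)) (\<Sum>j\<in>I. cscale (a j) (E j)))"
    using E by (intro ip_sum H_closed)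
  also have "\<dots> = (\<Sum>i\<in>I. a i * (\<Sum>j\<in>I. cnj (a j) * ip (E i) (E j)))"
    using E by (simp add: ip_sum_right ip_scale ip_scale_right H_closed sum_distrib_left mult.left_commute)
  also have "\<dots> = (\<Sum>i\<in>I. a i * cnj (a i))"
    using fin by (intro sum.cong) (auto simp: on if_distrib cong: if_cong)
  also have "\<dots> = of_real (\<Sum>i\<in>I. (cmod (a i))\<^sup>2)"
    by (simp add: complex_norm_square del: of_real_power)
  finally show ?thesis using E by (simp add: ip_norm_sq H_closed)
qed

text \<open>
  The projection \<open>p\<close> to the span of finitely many \<open>E i\<close> satisfies
  \<open>ip g p = \<parallel>p\<parallel>\<^sup>2\<close>, and \<open>\<parallel>g - p\<parallel>\<^sup>2 \<ge> 0\<close> bounds the partial sums by \<open>\<parallel>g\<parallel>\<^sup>2\<close>.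
\<close>

lemma (in hilbert_function_space) Bessel:
  assumes E: "\<And>i. E i \<in> H" and on: "\<And>i j. ip (E i) (E j) = (if i = j then 1 else 0)" and g: "g \<in> H"
  shows "summable (\<lambda>n. (cmod (ip g (E n)))\<^sup>2)"
proof (rule summableI_nonneg_bounded)
  fix n :: nat
  define p where "p = (\<Sum>i<n. cscale (ip g (E i)) (E i))"
  have p: "p \<in> H" unfolding p_def by (intro H_closed E)
  have "ip g p = of_real (\<Sum>i<n. (cmod (ip g (E i)))\<^sup>2)"
    unfolding p_def using g E
    by (simp add: ip_sum_right ip_scale_right H_closed complex_norm_square mult.commute del: of_real_power)
  moreover have "(ip_norm ip p)\<^sup>2 = (\<Sum>i<n. (cmod (ip g (E i)))\<^sup>2)"
    unfolding p_def by (intro ip_norm_orthogonal_sum E on) auto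
  moreover have "0 \<le> (ip_norm ip (g - p))\<^sup>2" by simp
  ultimately show "(\<Sum>i<n. (cmod (ip g (E i)))\<^sup>2) \<le> (ip_norm ip g)\<^sup>2"
    using g p by (simp add: ip_norm_diff_sq)
qed simp

lemma (in hilbert_function_space) orthonormal_series_converges:
  assumes E: "\<And>i. E i \<in> H" and on: "\<And>i j. ip (E i) (E j) = (if i = j then 1 else 0)"
    and a: "summable (\<lambda>n. (cmod (a n))\<^sup>2)"
  shows "\<exists>g\<in>H. (\<lambda>n. ip_norm ip ((\<Sum>i<n. cscale (a i) (E i)) - g)) \<longlonglongrightarrow> 0"
proof (rule complete)
  define s where "s n = (\<Sum>i<n. cscale (a i) (E i))" for n
  have sH: "s n \<in> H" for n unfolding s_def by (intro H_closed E)
  show "(\<Sum>i<n. cscale (a i) (E i)) \<in> H" for n by (intro H_closed E)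
  fix e :: real assume e: "e > 0"
  then obtain N where N: "\<And>m n. m \<ge> N \<Longrightarrow> norm (\<Sum>k=m..<n. (cmod (a k))\<^sup>2) < e\<^sup>2"
    using a unfolding summable_Cauchy by (metis zero_less_power)
  have main: "ip_norm ip (s n - s m) < e" if "N \<le> m" "m \<le> n" for m n
  proof -
    have "s n = s m + (\<Sum>i=m..<n. cscale (a i) (E i))"
      using that(2) unfolding s_def lessThan_atLeast0 by (subst sum.atLeastLessThan_concat) auto
    then have "s n - s m = (\<Sum>i=m..<n. cscale (a i) (E i))" by (auto simp: fun_eq_iff)
    then have "(ip_norm ip (s n - s m))\<^sup>2 = (\<Sum>i=m..<n. (cmod (a i))\<^sup>2)"
      by (simp add: ip_norm_orthogonal_sum E on)
    also have "\<dots> < e\<^sup>2" using N[OF that(1), of n] by simp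
    finally show ?thesis using e by (simp add: power2_less_imp_less)
  qed
  show "\<exists>N. \<forall>m\<ge>N. \<forall>n\<ge>N. ip_norm ip ((\<Sum>i<m. cscale (a i) (E i)) - (\<Sum>i<n. cscale (a i) (E i))) < e"
    unfolding s_def[symmetric]
  proof (intro exI allI impI)
    fix m n assume "N \<le> m" "N \<le> n"
    then show "ip_norm ip (s m - s n) < e"
      using main ip_norm_minus_commute[OF sH sH] by (metis nle_le)
  qed
qed

lemma (in hilbert_function_space) subspace_closed_span:
  assumes "S \<subseteq> H" shows "cfun_subspace (closed_span H ip S)" and "cfun_span S \<subseteq> closed_span H ip S"
    and "closed_span H ip S \<subseteq> H"
proof -
  have span_H: "cfun_span S \<subseteq> H" using assms subspace by (rule cfun.span_minimal)
  show sub: "cfun_span S \<subseteq> closed_span H ip S"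
  proof
    fix g assume "g \<in> cfun_span S"
    then show "g \<in> closed_span H ip S"
      using span_H ip_norm_diff_self[of g] unfolding closed_span_def by force
  qed
  show "closed_span H ip S \<subseteq> H" by (auto simp: closed_span_def)
  show "cfun_subspace (closed_span H ip S)"
  proof (rule cfun.subspaceI)
    show "0 \<in> closed_span H ip S" using sub cfun.span_zero by blast
  next
    fix f g assume f: "f \<in> closed_span H ip S" and g: "g \<in> closed_span H ip S"
    have "\<exists>h\<in>cfun_span S. ip_norm ip (f + g - h) < e" if "e > 0" for e
    proof -
      obtain h1 h2 where h: "h1 \<in> cfun_span S" "h2 \<in> cfun_span S"
        "ip_norm ip (f - h1) < e/2" "ip_norm ip (g - h2) < e/2"
        using f g \<open>e > 0\<close> unfolding closed_span_def by (auto dest!: spec[of _ "e/2"])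
      have fh: "f - h1 \<in> H" "g - h2 \<in> H"
        using h(1,2) f g span_H by (auto simp: closed_span_def intro!: diff_in)
      have "f + g - (h1 + h2) = (f - h1) + (g - h2)" by (auto simp: fun_eq_iff)
      then have "ip_norm ip (f + g - (h1 + h2)) = ip_norm ip ((f - h1) + (g - h2))"
        by (rule arg_cong)
      then have "ip_norm ip (f + g - (h1 + h2)) < e"
        using ip_norm_triangle[OF fh] h(3,4) by linarith
      then show ?thesis using cfun.span_add h by blast
    qed
    moreover have "f + g \<in> H" using f g by (simp add: closed_span_def add_in)
    ultimately show "f + g \<in> closed_span H ip S" by (simp add: closed_span_def)
  next
    fix c f assume f: "f \<in> closed_span H ip S"
    have "\<exists>h\<in>cfun_span S. ip_norm ip (cscale c f - h) < e" if "e > 0" for e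
    proof -
      have "e / (cmod c + 1) > 0" using that by (simp add: add_nonneg_pos)
      then obtain h where h: "h \<in> cfun_span S" "ip_norm ip (f - h) < e / (cmod c + 1)"
        using f unfolding closed_span_def by blast
      have fh: "f - h \<in> H" using f h span_H by (auto simp: closed_span_def H_closed)
      have "cscale c f - cscale c h = cscale c (f - h)" by (auto simp: fun_eq_iff algebra_simps)
      then have "ip_norm ip (cscale c f - cscale c h) = cmod c * ip_norm ip (f - h)"
        using fh by (simp add: ip_norm_cscale)
      also have "\<dots> \<le> (cmod c + 1) * ip_norm ip (f - h)"
        using ip_norm_nonneg[OF fh] by (intro mult_right_mono) auto
      also have "\<dots> < e"
        using h(2) by (simp add: pos_less_divide_eq add_nonneg_pos mult.commute)
      finally show ?thesis using cfun.span_scale h by blast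
    qed
    moreover have "cscale c f \<in> H" using f by (simp add: closed_span_def scale_in)
    ultimately show "cscale c f \<in> closed_span H ip S" by (simp add: closed_span_def)
  qed
qed

lemma (in hilbert_function_space) closed_span_closed:
  assumes S: "S \<subseteq> H" and s: "\<And>n. s n \<in> closed_span H ip S"
    and l: "l \<in> H" "(\<lambda>n. ip_norm ip (s n - l)) \<longlonglongrightarrow> 0"
  shows "l \<in> closed_span H ip S"
  unfolding closed_span_def
proof (intro CollectI conjI allI impI l)
  fix e :: real assume e: "e > 0"
  have sH: "s n \<in> H" for n using s subspace_closed_span(3)[OF S] by auto
  have "\<forall>\<^sub>F n in sequentially. ip_norm ip (s n - l) < e/2"
    using l(2) e by (intro order_tendstoD) auto
  then obtain n where n: "ip_norm ip (s n - l) < e/2" by (auto dest: eventually_happens)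
  obtain h where h: "h \<in> cfun_span S" "ip_norm ip (s n - h) < e/2"
    using s[of n] e unfolding closed_span_def by (auto dest!: spec[of _ "e/2"])
  have "h \<in> H" using h subspace_closed_span[OF S] by auto
  then have "ip_norm ip (l - h) < e"
    using ip_norm_diff_triangle[of l "s n" h] l(1) sH n h(2) ip_norm_minus_commute[of l "s n"] by simp
  then show "\<exists>h\<in>cfun_span S. ip_norm ip (l - h) < e" using h by blast
qed

section \<open>Boundedness of multipliers\<close>

lemma (in rkhs) norm_eval_le:
  assumes "F \<in> H" "y \<in> X"
  shows "cmod (F y) \<le> ip_norm ip F * ip_norm ip (kernel_fun X k y)"
  using Cauchy_Schwarz[OF assms(1) kernel_in[OF assms(2)]] reproducing[OF assms] by simp

text \<open>
  The functionals \<open>F \<mapsto> \<phi> y * F y / \<parallel>k\<^sub>y\<parallel>\<close>, for \<open>y \<in> Y\<close>, have norm \<open>\<bar>\<phi> y\<bar>\<close> and are bounded at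
  every single \<open>F\<close>, by the norm of \<open>\<phi> * F\<close>. So the claim is an instance of the uniform
  boundedness principle, and its proof is the elementary one of Sokal. If \<open>\<bar>\<phi> (y n)\<bar> > 4 ^ n\<close>,
  add to the partial sum reached so far the normalized kernel at \<open>y n\<close> times
  \<open>\<plusminus>(1/3) ^ n\<close>. One of the two signs makes the value of the functional at the new sum
  large, and all later summands together have too small a norm to spoil this.
\<close>

lemma (in rkhs) multiplier_bounded:
  assumes Y: "Y \<subseteq> X" and nz: "\<And>y. y \<in> Y \<Longrightarrow> k y y \<noteq> 0"
    and mult: "\<And>F. F \<in> H \<Longrightarrow> \<exists>G\<in>H. \<forall>y\<in>Y. G y = \<phi> y * F y"
  shows "bounded (\<phi> ` Y)"
proof (rule ccontr)
  assume unb: "\<not> bounded (\<phi> ` Y)"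
  have "\<exists>y\<in>Y. 4 ^ n < cmod (\<phi> y)" for n :: nat
    using unb unfolding bounded_iff by (auto simp: not_le)
  then obtain y where y: "\<And>n. y n \<in> Y" "\<And>n::nat. 4 ^ n < cmod (\<phi> (y n))" by metis
  have yX: "y n \<in> X" for n using y Y by auto
  define K where "K n = ip_norm ip (kernel_fun X k (y n))" for n
  define e where "e n = cscale (1 / of_real (K n)) (kernel_fun X k (y n))" for n
  have kH: "kernel_fun X k (y n) \<in> H" for n using kernel_in yX by blast
  have eH: "e n \<in> H" for n unfolding e_def by (intro scale_in kH)
  have K_pos: "K n > 0" for n
  proof -
    have "ip (kernel_fun X k (y n)) (kernel_fun X k (y n)) = k (y n) (y n)"
      using reproducing[OF kH yX] yX by (simp add: kernel_fun_def restrict0_def)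
    then have "K n \<noteq> 0" using nz[OF y(1)] ip_self[OF kH] by (auto simp: K_def)
    then show ?thesis using ip_norm_nonneg[OF kH] by (simp add: K_def order_less_le)
  qed
  have e_norm: "ip_norm ip (e n) = 1" for n
    using K_pos[of n] unfolding e_def by (subst ip_norm_cscale[OF kH]) (simp add: norm_divide K_def)
  have ip_e: "F (y n) = of_real (K n) * ip F (e n)" if "F \<in> H" for F n
    using that K_pos[of n] reproducing[OF that yX] kH by (simp add: e_def ip_scale_right)
  \<comment> \<open>The inner products of \<open>x + d\<close> and \<open>x - d\<close> with \<open>e n\<close> differ by \<open>2 * (1/3) ^ n\<close>, so one
     of them has absolute value at least \<open>(1/3) ^ n\<close>.\<close>
  have "\<exists>x. \<forall>n. x n \<in> H \<and> (ip_norm ip (x (Suc n) - x n) \<le> (1/3) ^ n \<and>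
      (1/3) ^ n \<le> cmod (ip (x (Suc n)) (e n)))"
  proof (rule dependent_nat_choice)
    show "\<exists>x. x \<in> H" using zero_in by blast
    fix x n assume x: "x \<in> H"
    define d where "d = cscale (of_real ((1/3) ^ n)) (e n)"
    have dH: "d \<in> H" unfolding d_def by (intro scale_in eH)
    have d_norm: "ip_norm ip d = (1/3) ^ n"
      unfolding d_def by (subst ip_norm_cscale[OF eH]) (simp add: e_norm norm_power norm_divide)
    have ip_d: "ip d (e n) = of_real ((1/3) ^ n)"
      unfolding d_def by (subst ip_scale[OF eH eH]) (simp add: ip_self[OF eH] e_norm)
    have "2 * (1/3) ^ n = cmod (ip (x + d) (e n) - ip (x - d) (e n))"
      using x dH eH by (simp add: ip_add ip_diff ip_d norm_mult norm_power norm_divide)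
    also have "\<dots> \<le> cmod (ip (x + d) (e n)) + cmod (ip (x - d) (e n))" by (rule norm_triangle_ineq4)
    finally have "(1/3) ^ n \<le> cmod (ip (x + d) (e n)) \<or> (1/3) ^ n \<le> cmod (ip (x - d) (e n))" by linarith
    moreover have "x + d - x = d" "x - (x - d) = d" by (auto simp: fun_eq_iff)
    ultimately show "\<exists>x'. x' \<in> H \<and> ip_norm ip (x' - x) \<le> (1/3) ^ n \<and> (1/3) ^ n \<le> cmod (ip x' (e n))"
      using x dH d_norm ip_norm_minus_commute[of "x - d" x] add_in[of x d] diff_in[of x d] by auto
  qed
  then obtain x where xH: "\<And>n. x n \<in> H"
    and step: "\<And>n. ip_norm ip (x (Suc n) - x n) \<le> (1/3) ^ n"
    and big: "\<And>n. (1/3) ^ n \<le> cmod (ip (x (Suc n)) (e n))" by auto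
  have tail: "ip_norm ip (x (n + d) - x n) \<le> 3/2 * (1/3) ^ n * (1 - (1/3) ^ d)" for n d
  proof (induction d)
    case 0
    have "ip_norm ip (x (n + 0) - x n) = 0" unfolding add_0_right by (rule ip_norm_diff_self)
    then show ?case by (simp only: power_0 diff_self mult_zero_right order_refl)
  next
    case (Suc d)
    have "ip_norm ip (x (n + Suc d) - x n) \<le> ip_norm ip (x (Suc (n + d)) - x (n + d)) + ip_norm ip (x (n + d) - x n)"
      using ip_norm_diff_triangle[OF xH xH xH] by simp
    also have "\<dots> \<le> (1/3) ^ (n + d) + 3/2 * (1/3) ^ n * (1 - (1/3) ^ d)"
      by (intro add_mono step Suc)
    also have "\<dots> = 3/2 * (1/3) ^ n * (1 - (1/3) ^ Suc d)"
    proof -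
      have "b * a + 3/2 * a * (1 - b) = 3/2 * a * (1 - 1/3 * b)" for a b :: real
        by (simp add: field_simps)
      from this[of "(1/3) ^ d" "(1/3) ^ n"] show ?thesis by (simp only: power_add power_Suc mult.commute[of "(1/3) ^ n"])
    qed
    finally show ?case .
  qed
  have tail': "ip_norm ip (x m - x n) \<le> 3/2 * (1/3) ^ n" if "n \<le> m" for m n
  proof -
    have "3/2 * (1/3) ^ n * (1 - (1/3) ^ (m - n)) \<le> 3/2 * (1/3::real) ^ n * 1"
      by (intro mult_left_mono) auto
    with tail[of n "m - n"] show ?thesis unfolding le_add_diff_inverse[OF that] by linarith
  qed
  have "\<exists>l\<in>H. (\<lambda>n. ip_norm ip (x n - l)) \<longlonglongrightarrow> 0"
  proof (rule complete[OF xH])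
    fix \<epsilon> :: real assume "\<epsilon> > 0"
    moreover have "(\<lambda>n. 3/2 * (1/3::real) ^ n) \<longlonglongrightarrow> 3/2 * 0"
      by (intro tendsto_mult tendsto_const LIMSEQ_power_zero) simp
    ultimately have "\<forall>\<^sub>F n in sequentially. 3/2 * (1/3) ^ n < \<epsilon>"
      by (intro order_tendstoD(2)) auto
    then obtain N where N: "\<And>n. n \<ge> N \<Longrightarrow> 3/2 * (1/3) ^ n < \<epsilon>"
      by (auto simp: eventually_sequentially)
    have "ip_norm ip (x m - x n) < \<epsilon>" if "N \<le> m" "N \<le> n" for m n
      using tail'[of m n] tail'[of n m] N[of n] N[of m] that ip_norm_minus_commute[OF xH xH, of m n]
      by (cases "m \<le> n") auto
    then show "\<exists>N. \<forall>m\<ge>N. \<forall>n\<ge>N. ip_norm ip (x m - x n) < \<epsilon>" by blast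
  qed
  then obtain l where l: "l \<in> H" "(\<lambda>n. ip_norm ip (x n - l)) \<longlonglongrightarrow> 0" by blast
  have l_near: "ip_norm ip (x n - l) \<le> 3/2 * (1/3) ^ n" for n
  proof (rule LIMSEQ_le_const)
    show "(\<lambda>m. 3/2 * (1/3) ^ n + ip_norm ip (x m - l)) \<longlonglongrightarrow> 3/2 * (1/3) ^ n"
      using tendsto_add[OF tendsto_const l(2), of "3/2 * (1/3) ^ n"] by simp
    show "\<exists>N. \<forall>m\<ge>N. ip_norm ip (x n - l) \<le> 3/2 * (1/3) ^ n + ip_norm ip (x m - l)"
    proof (intro exI[of _ n] allI impI)
      fix m assume "n \<le> m"
      then show "ip_norm ip (x n - l) \<le> 3/2 * (1/3) ^ n + ip_norm ip (x m - l)"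
        using ip_norm_diff_triangle[OF xH[of n] xH[of m] l(1)] tail'[of n m]
          ip_norm_minus_commute[OF xH xH, of n m] by linarith
    qed
  qed
  \<comment> \<open>The later steps have total length at most \<open>3/2 * (1/3) ^ Suc n\<close>, half of what was gained.\<close>
  have l_big: "1/2 * (1/3) ^ n \<le> cmod (ip l (e n))" for n
  proof -
    have "cmod (ip (x (Suc n)) (e n) - ip l (e n)) \<le> 1/2 * (1/3) ^ n"
      using Cauchy_Schwarz[OF diff_in[OF xH[of "Suc n"] l(1)] eH[of n]] l_near[of "Suc n"] e_norm[of n]
      by (simp add: ip_diff xH l(1) eH)
    then show ?thesis using big[of n] norm_triangle_ineq2[of "ip (x (Suc n)) (e n)" "ip l (e n)"] by simp
  qed
  obtain G where G: "G \<in> H" "\<And>y. y \<in> Y \<Longrightarrow> G y = \<phi> y * l y" using mult[OF l(1)] by blast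
  have bound: "(4/3) ^ n \<le> 2 * ip_norm ip G" for n
  proof -
    have "(4 ^ n * (1/2 * (1/3) ^ n)) * K n \<le> (cmod (\<phi> (y n)) * cmod (ip l (e n))) * K n"
      using l_big[of n] y(2)[of n] K_pos[of n] by (intro mult_right_mono mult_mono) auto
    also have "\<dots> = cmod (G (y n))"
      using G(2)[OF y(1)] ip_e[OF l(1), of n] K_pos[of n] by (simp add: norm_mult)
    also have "\<dots> \<le> ip_norm ip G * K n" unfolding K_def by (rule norm_eval_le[OF G(1) yX])
    finally have "4 ^ n * (1/2 * (1/3) ^ n) \<le> ip_norm ip G" using K_pos[of n] by simp
    then show ?thesis by (simp add: power_divide)
  qed
  obtain n where "2 * ip_norm ip G < (4/3) ^ n"
    using real_arch_pow[of "4/3" "2 * ip_norm ip G"] by auto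
  then show False using bound[of n] by simp
qed

section \<open>Monomials in a reproducing kernel Hilbert space over a disc\<close>

text \<open>
  The summands are the powers of \<open>q = exp (2 \<pi> \<i> (n - m) / N)\<close>, an \<open>N\<close>-th root of unity
  that equals \<open>1\<close> exactly for \<open>m \<equiv> n\<close> modulo \<open>N\<close>. Averaging over roots of unity replaces
  integration over a circle, here and in the discrete Parseval identity below.
\<close>

lemma root_of_unity_orthogonality:
  assumes N: "N > 0"
  shows "(\<Sum>j<N. cis (2 * pi * real j / real N) ^ n * cnj (cis (2 * pi * real j / real N) ^ m))
    = (if m mod N = n mod N then of_nat N else 0)"
proof -
  define q where "q = cis (2 * pi * (real n - real m) / real N)"
  have term_eq: "cis (2 * pi * real j / real N) ^ n * cnj (cis (2 * pi * real j / real N) ^ m) = q ^ j" for j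
    unfolding q_def Complex.DeMoivre cis_cnj cis_mult
    by (rule arg_cong[of _ _ cis]) (simp add: algebra_simps diff_divide_distrib)
  have q_eq_1: "q = 1 \<longleftrightarrow> m mod N = n mod N"
  proof -
    have "q = 1 \<longleftrightarrow> (\<exists>i. 2 * pi * (real n - real m) / real N = of_int i * (2 * pi))"
      unfolding q_def by (rule cis_eq_1_iff)
    also have "\<dots> \<longleftrightarrow> (\<exists>i. real_of_int (int n - int m) = of_int (int N * i))"
    proof (rule ex_cong1)
      fix i
      have "2 * pi * (real n - real m) / real N = of_int i * (2 * pi)
          \<longleftrightarrow> (2 * pi) * (real n - real m) = (2 * pi) * (of_int i * real N)"
        using N by (simp add: divide_eq_eq mult_ac)
      also have "\<dots> \<longleftrightarrow> real_of_int (int n - int m) = of_int (int N * i)"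
        by (subst mult_cancel_left) (simp add: mult.commute)
      finally show "2 * pi * (real n - real m) / real N = of_int i * (2 * pi)
          \<longleftrightarrow> real_of_int (int n - int m) = of_int (int N * i)" .
    qed
    also have "\<dots> \<longleftrightarrow> int N dvd int n - int m" unfolding of_int_eq_iff dvd_def ..
    also have "\<dots> \<longleftrightarrow> m mod N = n mod N"
      by (metis mod_eq_dvd_iff of_nat_eq_iff of_nat_mod)
    finally show ?thesis .
  qed
  have "q ^ N = 1"
  proof -
    have "q ^ N = cis (2 * pi * of_int (int n - int m))"
      using N unfolding q_def Complex.DeMoivre by simp
    also have "\<dots> = 1" by (rule cis_multiple_2pi) auto
    finally show ?thesis .
  qed
  then show ?thesis
    using q_eq_1 by (simp only: term_eq) (auto simp: geometric_sum)
qed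

lemma sums_norm_le_geometric_tail:
  fixes t :: "nat \<Rightarrow> complex"
  assumes t: "t sums S" and zero: "\<And>m. m < K \<Longrightarrow> t m = 0" and le: "\<And>m. cmod (t m) \<le> q ^ m"
    and q: "0 \<le> q" "q < 1"
  shows "cmod S \<le> q ^ K / (1 - q)"
proof -
  have "(\<lambda>m. t (m + K)) sums S"
    using sums_iff_shift[of t K] zero t by (auto simp: sums_iff_shift)
  moreover have "(\<lambda>m. q ^ (m + K)) sums (1 / (1 - q) * q ^ K)"
    unfolding power_add using q by (intro sums_mult2 geometric_sums) auto
  ultimately show ?thesis
    using norm_suminf_le[of "\<lambda>m. t (m + K)" "\<lambda>m. q ^ (m + K)"] le
    by (simp add: sums_iff)
qed

text \<open>
  A reproducing kernel Hilbert space with a disc \<open>\<gamma>\<close> in its domain along which the kernel is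
  a power series in \<open>z * cnj w\<close>. The aim is to show that the functions \<open>F \<circ> \<gamma>\<close>, for \<open>F \<in> H\<close>,
  are exactly the power series \<open>\<Sum>n. u n * z ^ n\<close> with finite \<open>\<Sum>n. \<bar>u n\<bar>\<^sup>2 / c n\<close>. For
  this, \<open>H\<close> must contain functions that restrict to monomials. They have to be constructed from
  the kernel functions, since nothing else is known to lie in \<open>H\<close>.
\<close>

locale rkhs_on_disc = rkhs X H ip k for X :: "'a set" and H ip k +
  fixes \<gamma> :: "complex \<Rightarrow> 'a" and c :: "nat \<Rightarrow> real"
  assumes disc_in: "cmod z < 1 \<Longrightarrow> \<gamma> z \<in> X"
    and kernel_sums: "\<lbrakk>cmod z < 1; cmod w < 1\<rbrakk>
      \<Longrightarrow> (\<lambda>n. of_real (c n) * (z * cnj w) ^ n) sums k (\<gamma> z) (\<gamma> w)"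
    and c_pos: "c n > 0" and c_le_1: "c n \<le> 1"

definition (in rkhs_on_disc) ker :: "complex \<Rightarrow> 'a \<Rightarrow> complex" where
  "ker w = kernel_fun X k (\<gamma> w)"

text \<open>
  The discrete Fourier coefficient of the map from \<open>w\<close> to the kernel function at \<open>\<gamma> w\<close>, on
  the circle of radius \<open>1/2\<close>. It keeps from the power series of the kernel the terms whose
  exponent is congruent to \<open>n\<close> modulo \<open>N\<close>, so for large \<open>N\<close> it is close to a multiple of
  \<open>z ^ n\<close>. Any other radius between \<open>0\<close> and \<open>1\<close> would do as well.
\<close>

definition (in rkhs_on_disc) averaged_kernel :: "nat \<Rightarrow> nat \<Rightarrow> 'a \<Rightarrow> complex" where
  "averaged_kernel n N = cscale (1 / of_nat N) (\<Sum>j<N. cscale (cis (2 * pi * real j / real N) ^ n)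
     (ker (cis (2 * pi * real j / real N) / 2)))"

lemma (in rkhs_on_disc) ker_in: "cmod w < 1 \<Longrightarrow> ker w \<in> H"
  unfolding ker_def by (intro kernel_in disc_in)

lemma (in rkhs_on_disc) ip_ker: "F \<in> H \<Longrightarrow> cmod w < 1 \<Longrightarrow> ip F (ker w) = F (\<gamma> w)"
  unfolding ker_def by (intro reproducing disc_in)

lemma (in rkhs_on_disc) ker_apply: "cmod z < 1 \<Longrightarrow> cmod w < 1 \<Longrightarrow> ker w (\<gamma> z) = k (\<gamma> z) (\<gamma> w)"
  by (simp add: ker_def kernel_fun_def restrict0_def disc_in)

lemma half_root_in_disc: "cmod (cis x / 2) < 1"
  by (simp add: norm_divide)

lemma (in rkhs_on_disc) averaged_kernel_in: "averaged_kernel n N \<in> H"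
  unfolding averaged_kernel_def by (intro H_closed ker_in half_root_in_disc)

lemma (in rkhs_on_disc) averaged_kernel_sums:
  assumes N: "N > 0" and z: "cmod z < 1"
  shows "(\<lambda>m. if m mod N = n mod N then of_real (c m) * (z / 2) ^ m else 0)
    sums averaged_kernel n N (\<gamma> z)"
proof -
  define \<omega> where "\<omega> j = cis (2 * pi * real j / real N)" for j
  have "(\<lambda>m. 1 / of_nat N * (\<Sum>j<N. \<omega> j ^ n * (of_real (c m) * (z * cnj (\<omega> j / 2)) ^ m)))
      sums (1 / of_nat N * (\<Sum>j<N. \<omega> j ^ n * k (\<gamma> z) (\<gamma> (\<omega> j / 2))))"
    using z half_root_in_disc unfolding \<omega>_def
    by (intro sums_mult sums_sum kernel_sums)
  also have "1 / of_nat N * (\<Sum>j<N. \<omega> j ^ n * k (\<gamma> z) (\<gamma> (\<omega> j / 2))) = averaged_kernel n N (\<gamma> z)"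
    using z half_root_in_disc by (simp add: averaged_kernel_def \<omega>_def ker_apply)
  also have "(\<lambda>m. 1 / of_nat N * (\<Sum>j<N. \<omega> j ^ n * (of_real (c m) * (z * cnj (\<omega> j / 2)) ^ m)))
      = (\<lambda>m. if m mod N = n mod N then of_real (c m) * (z / 2) ^ m else 0)"
  proof
    fix m
    have "(\<Sum>j<N. \<omega> j ^ n * (of_real (c m) * (z * cnj (\<omega> j / 2)) ^ m))
        = of_real (c m) * (z / 2) ^ m * (\<Sum>j<N. \<omega> j ^ n * cnj (\<omega> j ^ m))"
      by (simp add: sum_distrib_left power_mult_distrib power_divide mult_ac)
    then show "1 / of_nat N * (\<Sum>j<N. \<omega> j ^ n * (of_real (c m) * (z * cnj (\<omega> j / 2)) ^ m))
        = (if m mod N = n mod N then of_real (c m) * (z / 2) ^ m else 0)"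
      using N unfolding \<omega>_def root_of_unity_orthogonality[OF N] by simp
  qed
  finally show ?thesis .
qed

lemma (in rkhs_on_disc) ip_averaged_kernel_sums:
  assumes N: "N > 0" and M: "M > 0"
  shows "(\<lambda>m. if m mod N = n mod N \<and> l mod M = m mod M then of_real (c m / 4 ^ m) else 0)
    sums ip (averaged_kernel n N) (averaged_kernel l M)"
proof -
  define \<omega> where "\<omega> j = cis (2 * pi * real j / real M)" for j
  let ?t = "\<lambda>m z. if m mod N = n mod N then of_real (c m) * (z / 2) ^ m else (0::complex)"
  have "(\<lambda>m. 1 / of_nat M * (\<Sum>j<M. cnj (\<omega> j ^ l) * ?t m (\<omega> j / 2)))
      sums (1 / of_nat M * (\<Sum>j<M. cnj (\<omega> j ^ l) * averaged_kernel n N (\<gamma> (\<omega> j / 2))))"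
    using half_root_in_disc unfolding \<omega>_def
    by (intro sums_mult sums_sum averaged_kernel_sums N)
  also have "1 / of_nat M * (\<Sum>j<M. cnj (\<omega> j ^ l) * averaged_kernel n N (\<gamma> (\<omega> j / 2)))
      = ip (averaged_kernel n N) (averaged_kernel l M)"
    unfolding averaged_kernel_def[of l M] \<omega>_def
    by (simp add: ip_scale_right ip_sum_right H_closed ker_in half_root_in_disc averaged_kernel_in ip_ker)
  also have "(\<lambda>m. 1 / of_nat M * (\<Sum>j<M. cnj (\<omega> j ^ l) * ?t m (\<omega> j / 2)))
      = (\<lambda>m. if m mod N = n mod N \<and> l mod M = m mod M then of_real (c m / 4 ^ m) else 0)"
  proof
    fix m
    have "(\<Sum>j<M. cnj (\<omega> j ^ l) * ?t m (\<omega> j / 2))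
        = ?t m (1 / 2) * (\<Sum>j<M. \<omega> j ^ m * cnj (\<omega> j ^ l))"
      by (simp add: sum_distrib_left power_divide mult_ac)
    then show "1 / of_nat M * (\<Sum>j<M. cnj (\<omega> j ^ l) * ?t m (\<omega> j / 2))
        = (if m mod N = n mod N \<and> l mod M = m mod M then of_real (c m / 4 ^ m) else 0)"
      using M unfolding \<omega>_def root_of_unity_orthogonality[OF M]
      by (simp add: power_divide flip: power_mult_distrib)
  qed
  finally show ?thesis .
qed

text \<open>
  Among the exponents below \<open>N\<close> only \<open>n\<close> itself is congruent to \<open>n\<close>, so what remains is a
  tail that starts at exponent \<open>N\<close>.
\<close>

lemma (in rkhs_on_disc) averaged_kernel_apply_approx:
  assumes N: "n < N" and z: "cmod z < 1"
  shows "cmod (averaged_kernel n N (\<gamma> z) - of_real (c n) * (z / 2) ^ n) \<le> (1/2) ^ N / (1 - 1/2)"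
proof (rule sums_norm_le_geometric_tail)
  let ?t = "\<lambda>m. (if m mod N = n mod N then of_real (c m) * (z / 2) ^ m else 0)
      - (if m = n then of_real (c m) * (z / 2) ^ m else (0::complex))"
  show "?t sums (averaged_kernel n N (\<gamma> z) - of_real (c n) * (z / 2) ^ n)"
    using N z by (intro sums_diff averaged_kernel_sums sums_single) auto
  show "?t m = 0" if "m < N" for m using that N by simp
  show "cmod (?t m) \<le> (1/2) ^ m" for m
  proof -
    have "c m * cmod (z / 2) ^ m \<le> 1 * (1/2) ^ m"
      using c_le_1[of m] z by (intro mult_mono power_mono) (auto simp: norm_divide)
    then show ?thesis using c_pos[of m] by (auto simp: norm_mult norm_power)
  qed
qed auto

lemma (in rkhs_on_disc) ip_averaged_kernel_approx:
  assumes "n < K" "l < K" "K \<le> N" "K \<le> M"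
  shows "cmod (ip (averaged_kernel n N) (averaged_kernel l M)
    - of_real (if n = l then c n / 4 ^ n else 0)) \<le> (1/4) ^ K / (1 - 1/4)"
proof (rule sums_norm_le_geometric_tail)
  let ?t = "\<lambda>m. (if m mod N = n mod N \<and> l mod M = m mod M then of_real (c m / 4 ^ m) else 0)
      - (if m = n then of_real (if n = l then c m / 4 ^ m else 0) else (0::complex))"
  show "?t sums (ip (averaged_kernel n N) (averaged_kernel l M)
    - of_real (if n = l then c n / 4 ^ n else 0))"
    using assms by (intro sums_diff ip_averaged_kernel_sums sums_single) auto
  show "?t m = 0" if "m < K" for m using that assms by simp
  show "cmod (?t m) \<le> (1/4) ^ m" for m
    using c_le_1[of m] c_pos[of m] by (auto simp: power_divide norm_divide norm_power field_simps)
qed auto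

text \<open>
  For fixed \<open>n\<close>, all inner products of averaged kernels with large parameters are close to
  \<open>c n / 4 ^ n\<close>; hence so are the three terms of \<open>\<parallel>x - y\<parallel>\<^sup>2 = \<parallel>x\<parallel>\<^sup>2 - 2 Re \<langle>x, y\<rangle> + \<parallel>y\<parallel>\<^sup>2\<close>,
  up to their coefficients \<open>1, -2, 1\<close>, which cancel. So the sequence is Cauchy.
\<close>

lemma (in rkhs_on_disc) averaged_kernel_tendsto:
  "\<exists>Y\<in>closed_span H ip (kernel_fun X k ` \<gamma> ` ball 0 1).
    (\<lambda>N. ip_norm ip (averaged_kernel n N - Y)) \<longlonglongrightarrow> 0"
proof -
  define S where "S = kernel_fun X k ` \<gamma> ` ball 0 1"
  have S: "S \<subseteq> H" unfolding S_def using kernel_in disc_in by auto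
  have ker_S: "ker w \<in> cfun_span S" if "cmod w < 1" for w
    using that unfolding S_def ker_def by (intro cfun.span_base) auto
  have span: "averaged_kernel n N \<in> cfun_span S" for N
    unfolding averaged_kernel_def by (intro cfun.span_scale cfun.span_sum ker_S half_root_in_disc)
  have lim: "(\<lambda>K. 4 * ((1/4) ^ K / (1 - 1/4))) \<longlonglongrightarrow> (4 * (0 / (1 - 1/4)) :: real)"
    by (intro tendsto_intros LIMSEQ_power_zero) auto
  have "\<exists>Y\<in>H. (\<lambda>N. ip_norm ip (averaged_kernel n N - Y)) \<longlonglongrightarrow> 0"
  proof (rule complete[OF averaged_kernel_in])
    fix e :: real assume e: "e > 0"
    have "\<forall>\<^sub>F K in sequentially. 4 * ((1/4) ^ K / (1 - 1/4)) < e\<^sup>2"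
      using e by (intro order_tendstoD(2)[OF lim]) auto
    then obtain K0 where K0: "\<And>K. K \<ge> K0 \<Longrightarrow> 4 * ((1/4) ^ K / (1 - 1/4)) < e\<^sup>2"
      by (auto simp: eventually_sequentially)
    define K where "K = max K0 (Suc n)"
    have "ip_norm ip (averaged_kernel n N - averaged_kernel n M) < e" if "K \<le> N" "K \<le> M" for N M
    proof -
      have approx: "\<bar>Re (ip (averaged_kernel n N') (averaged_kernel n M')) - c n / 4 ^ n\<bar> \<le> (1/4) ^ K / (1 - 1/4)"
        if "K \<le> N'" "K \<le> M'" for N' M'
      proof -
        have "cmod (ip (averaged_kernel n N') (averaged_kernel n M') - of_real (c n / 4 ^ n)) \<le> (1/4) ^ K / (1 - 1/4)"
          using ip_averaged_kernel_approx[of n K n N' M'] that by (simp add: K_def)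
        then show ?thesis
          using abs_Re_le_cmod[of "ip (averaged_kernel n N') (averaged_kernel n M') - of_real (c n / 4 ^ n)"] by simp
      qed
      have "(ip_norm ip (averaged_kernel n N - averaged_kernel n M))\<^sup>2 \<le> 4 * ((1/4) ^ K / (1 - 1/4))"
        unfolding ip_norm_diff_sq[OF averaged_kernel_in averaged_kernel_in] ip_norm_sq[OF averaged_kernel_in]
        using approx[OF that(1,1)] approx[OF that] approx[OF that(2,2)] by linarith
      also have "\<dots> < e\<^sup>2" using K0[of K] by (simp add: K_def)
      finally show ?thesis using e by (simp add: power2_less_imp_less)
    qed
    then show "\<exists>K. \<forall>N\<ge>K. \<forall>M\<ge>K. ip_norm ip (averaged_kernel n N - averaged_kernel n M) < e" by blast
  qed
  then obtain Y where Y: "Y \<in> H" "(\<lambda>N. ip_norm ip (averaged_kernel n N - Y)) \<longlonglongrightarrow> 0" by blast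
  moreover have "Y \<in> closed_span H ip S"
    by (rule closed_span_closed[OF S subsetD[OF subspace_closed_span(2)[OF S] span] Y])
  ultimately show ?thesis unfolding S_def by blast
qed

text \<open>
  Orthogonality comes from the average: no exponent is congruent to both \<open>n\<close> and \<open>l\<close> modulo a
  large \<open>N\<close> unless \<open>n = l\<close>. The limits of the averaged kernels have square norm
  \<open>c n / 4 ^ n\<close>, the powers of \<open>4\<close> and \<open>2\<close> being those of the radius \<open>1/2\<close>.
\<close>

lemma (in rkhs_on_disc) orthonormal_monomials:
  "\<exists>E. (\<forall>n. E n \<in> closed_span H ip (kernel_fun X k ` \<gamma> ` ball 0 1)) \<and>
    (\<forall>n m. ip (E n) (E m) = (if n = m then 1 else 0)) \<and>
    (\<forall>n z. cmod z < 1 \<longrightarrow> E n (\<gamma> z) = of_real (sqrt (c n)) * z ^ n)"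
proof -
  define C where "C = closed_span H ip (kernel_fun X k ` \<gamma> ` ball 0 1)"
  have S: "kernel_fun X k ` \<gamma> ` ball 0 1 \<subseteq> H" using kernel_in disc_in by auto
  note C = subspace_closed_span[OF S, folded C_def]
  obtain Y where YC: "\<And>n. Y n \<in> C" and Y: "\<And>n. (\<lambda>N. ip_norm ip (averaged_kernel n N - Y n)) \<longlonglongrightarrow> 0"
    using averaged_kernel_tendsto unfolding C_def by metis
  have YH: "Y n \<in> H" for n using YC C(3) by auto
  have ip_Y: "ip (Y n) (Y l) = of_real (if n = l then c n / 4 ^ n else 0)" for n l
  proof (rule LIMSEQ_unique)
    show "(\<lambda>N. ip (averaged_kernel n N) (averaged_kernel l N)) \<longlonglongrightarrow> ip (Y n) (Y l)"
      by (intro tendsto_ip averaged_kernel_in YH Y)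
    have "(\<lambda>N. (1/4) ^ N / (1 - 1/4)) \<longlonglongrightarrow> (0 / (1 - 1/4) :: real)"
      by (intro tendsto_intros LIMSEQ_power_zero) auto
    from this[unfolded div_0]
    have "(\<lambda>N. ip (averaged_kernel n N) (averaged_kernel l N)
        - of_real (if n = l then c n / 4 ^ n else 0)) \<longlonglongrightarrow> 0"
      by (rule Lim_null_comparison[OF eventually_sequentiallyI[of "Suc (max n l)"], rotated])
        (rule ip_averaged_kernel_approx, auto)
    then show "(\<lambda>N. ip (averaged_kernel n N) (averaged_kernel l N))
        \<longlonglongrightarrow> of_real (if n = l then c n / 4 ^ n else 0)" by (rule LIM_zero_cancel)
  qed
  have Y_apply: "Y n (\<gamma> z) = of_real (c n) * (z / 2) ^ n" if z: "cmod z < 1" for n z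
  proof (rule LIMSEQ_unique)
    have "(\<lambda>N. ip (averaged_kernel n N) (ker z)) \<longlonglongrightarrow> ip (Y n) (ker z)"
      by (intro tendsto_ip_left averaged_kernel_in YH Y ker_in z)
    then show "(\<lambda>N. averaged_kernel n N (\<gamma> z)) \<longlonglongrightarrow> Y n (\<gamma> z)"
      by (simp add: ip_ker averaged_kernel_in YH z)
    have "(\<lambda>N. (1/2) ^ N / (1 - 1/2)) \<longlonglongrightarrow> (0 / (1 - 1/2) :: real)"
      by (intro tendsto_intros LIMSEQ_power_zero) auto
    from this[unfolded div_0]
    have "(\<lambda>N. averaged_kernel n N (\<gamma> z) - of_real (c n) * (z / 2) ^ n) \<longlonglongrightarrow> 0"
      by (rule Lim_null_comparison[OF eventually_sequentiallyI[of "Suc n"], rotated])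
        (rule averaged_kernel_apply_approx[OF _ z], auto)
    then show "(\<lambda>N. averaged_kernel n N (\<gamma> z)) \<longlonglongrightarrow> of_real (c n) * (z / 2) ^ n"
      by (rule LIM_zero_cancel)
  qed
  define E where "E n = cscale (of_real (2 ^ n / sqrt (c n))) (Y n)" for n
  have "E n \<in> C" for n unfolding E_def by (intro cfun.subspace_scale C YC)
  moreover have "ip (E n) (E m) = (if n = m then 1 else 0)" for n m
  proof -
    have "(2 ^ n / sqrt (c n)) * ((2 ^ n / sqrt (c n)) * (c n / 4 ^ n)) = 1" for n
      using c_pos[of n] by (simp add: field_simps flip: power_mult_distrib)
    then have "of_real (2 ^ n / sqrt (c n)) * (of_real (2 ^ n / sqrt (c n)) * of_real (c n / 4 ^ n)) = (1::complex)" for n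
      by (metis of_real_mult of_real_1)
    then show ?thesis unfolding E_def
      by (simp add: ip_scale ip_scale_right YH H_closed ip_Y)
  qed
  moreover have "E n (\<gamma> z) = of_real (sqrt (c n)) * z ^ n" if "cmod z < 1" for n z
  proof -
    have "sqrt (c n) * sqrt (c n) = c n" using c_pos[of n] by simp
    then have "complex_of_real (sqrt (c n)) * of_real (sqrt (c n)) = of_real (c n)" by (metis of_real_mult)
    then show ?thesis using that c_pos[of n] unfolding E_def
      by (simp add: Y_apply power_divide field_simps)
  qed
  ultimately show ?thesis unfolding C_def by blast
qed

text \<open>
  The functions \<open>E m\<close> exhaust the kernel function at \<open>\<gamma> w\<close>: it is the norm limit of
  \<open>\<Sum>m<N. sqrt (c m) * cnj w ^ m * E m\<close>. Taking inner products of \<open>F\<close> with these sums expands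
  \<open>F (\<gamma> w)\<close> as a power series in \<open>w\<close> with coefficients \<open>sqrt (c n) * ip F (E n)\<close>, and
  Bessel's inequality gives the weighted summability.
\<close>

lemma (in rkhs_on_disc) pullback_power_series:
  assumes F: "F \<in> H"
  shows "\<exists>u. summable (\<lambda>n. (cmod (u n))\<^sup>2 / c n) \<and> (\<forall>z. cmod z < 1 \<longrightarrow> (\<lambda>n. u n * z ^ n) sums F (\<gamma> z))"
proof -
  have S: "kernel_fun X k ` \<gamma> ` ball 0 1 \<subseteq> H" using kernel_in disc_in by auto
  obtain E where EC: "\<And>n. E n \<in> closed_span H ip (kernel_fun X k ` \<gamma> ` ball 0 1)"
    and on: "\<And>n m. ip (E n) (E m) = (if n = m then 1 else 0)"
    and E_apply: "\<And>n z. cmod z < 1 \<Longrightarrow> E n (\<gamma> z) = of_real (sqrt (c n)) * z ^ n"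
    using orthonormal_monomials by metis
  have EH: "E n \<in> H" for n using EC subspace_closed_span(3)[OF S] by auto
  have sqrt_sq: "complex_of_real (sqrt (c n)) * of_real (sqrt (c n)) = of_real (c n)" for n
    using c_pos[of n] by (metis abs_of_pos of_real_mult real_sqrt_abs2 real_sqrt_mult_self)
  have series: "(\<lambda>n. (of_real (sqrt (c n)) * ip F (E n)) * w ^ n) sums F (\<gamma> w)" if w: "cmod w < 1" for w
  proof -
    define p where "p N = (\<Sum>m<N. cscale (of_real (sqrt (c m)) * cnj w ^ m) (E m))" for N
    have pH: "p N \<in> H" for N unfolding p_def by (intro H_closed EH)
    define s where "s N = (\<Sum>m<N. c m * (cmod w)\<^sup>2 ^ m)" for N
    have ww: "w ^ m * cnj w ^ m = of_real ((cmod w)\<^sup>2 ^ m)" for m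
      by (metis complex_norm_square of_real_power power_mult_distrib)
    have ip_p: "ip (p N) (ker w) = of_real (s N)" for N
    proof -
      have "ip (p N) (ker w) = (\<Sum>m<N. (of_real (sqrt (c m)) * of_real (sqrt (c m))) * (w ^ m * cnj w ^ m))"
        unfolding ip_ker[OF pH w] unfolding p_def by (simp add: E_apply w mult_ac)
      then show ?thesis unfolding sqrt_sq ww s_def by simp
    qed
    have norm_p: "(ip_norm ip (p N))\<^sup>2 = s N" for N
    proof -
      have "(cmod (of_real (sqrt (c m)) * cnj w ^ m))\<^sup>2 = c m * (cmod w)\<^sup>2 ^ m" for m
        using c_pos[of m] by (simp add: norm_mult norm_power power_mult_distrib power_mult[symmetric] mult.commute)
      then show ?thesis unfolding p_def s_def ip_norm_orthogonal_sum[OF EH on finite_lessThan] by simp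
    qed
    have "(\<lambda>n. of_real (c n * (cmod w)\<^sup>2 ^ n)) sums ip (ker w) (ker w)"
      using kernel_sums[OF w w] w
      by (simp add: ip_ker ker_in ker_apply of_real_power[symmetric] complex_norm_square[symmetric] del: of_real_power)
    then have "(\<lambda>N. complex_of_real (s N)) \<longlonglongrightarrow> ip (ker w) (ker w)"
      by (simp add: sums_def s_def)
    then have "s \<longlonglongrightarrow> Re (ip (ker w) (ker w))" using tendsto_Re by fastforce
    then have "s \<longlonglongrightarrow> (ip_norm ip (ker w))\<^sup>2" by (simp add: ip_norm_sq ker_in w)
    then have "(\<lambda>N. sqrt ((ip_norm ip (ker w))\<^sup>2 - s N)) \<longlonglongrightarrow> sqrt ((ip_norm ip (ker w))\<^sup>2 - (ip_norm ip (ker w))\<^sup>2)"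
      by (intro tendsto_intros)
    moreover have "sqrt ((ip_norm ip (ker w))\<^sup>2 - s N) = ip_norm ip (p N - ker w)" for N
      using ip_norm_diff_sq[OF pH ker_in[OF w], of N] ip_norm_nonneg[OF diff_in[OF pH ker_in[OF w]], of N]
      by (simp add: norm_p ip_p real_sqrt_unique)
    ultimately have "(\<lambda>N. ip_norm ip (p N - ker w)) \<longlonglongrightarrow> 0" by simp
    then have "(\<lambda>N. ip (p N) F) \<longlonglongrightarrow> ip (ker w) F" by (intro tendsto_ip_left pH ker_in w F)
    then have "(\<lambda>N. cnj (ip (p N) F)) \<longlonglongrightarrow> cnj (ip (ker w) F)" by (intro tendsto_cnj)
    moreover have "cnj (ip (ker w) F) = F (\<gamma> w)"
      using ip_cnj[OF ker_in[OF w] F] ip_ker[OF F w] by simp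
    moreover have "cnj (ip (p N) F) = (\<Sum>m<N. (of_real (sqrt (c m)) * ip F (E m)) * w ^ m)" for N
    proof -
      have "cnj (ip (p N) F) = ip F (p N)" using ip_cnj[OF pH F] by simp
      then show ?thesis unfolding p_def
        by (simp add: ip_sum_right ip_scale_right H_closed EH F mult_ac)
    qed
    ultimately show ?thesis by (simp add: sums_def)
  qed
  have "summable (\<lambda>n. (cmod (of_real (sqrt (c n)) * ip F (E n)))\<^sup>2 / c n)"
  proof -
    have "(cmod (of_real (sqrt (c n)) * ip F (E n)))\<^sup>2 / c n = (cmod (ip F (E n)))\<^sup>2" for n
      using c_pos[of n] by (simp add: norm_mult power_mult_distrib)
    then show ?thesis using Bessel[OF EH on F] by simp
  qed
  then show ?thesis
    using series by (intro exI[of _ "\<lambda>n. of_real (sqrt (c n)) * ip F (E n)"] conjI allI impI)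
qed

lemma (in rkhs_on_disc) power_series_in_closed_span:
  assumes u: "summable (\<lambda>n. (cmod (u n))\<^sup>2 / c n)"
  shows "\<exists>F\<in>closed_span H ip (kernel_fun X k ` \<gamma> ` ball 0 1).
    \<forall>z. cmod z < 1 \<longrightarrow> (\<lambda>n. u n * z ^ n) sums F (\<gamma> z)"
proof -
  have S: "kernel_fun X k ` \<gamma> ` ball 0 1 \<subseteq> H" using kernel_in disc_in by auto
  note C = subspace_closed_span[OF S]
  obtain E where EC: "\<And>n. E n \<in> closed_span H ip (kernel_fun X k ` \<gamma> ` ball 0 1)"
    and on: "\<And>n m. ip (E n) (E m) = (if n = m then 1 else 0)"
    and E_apply: "\<And>n z. cmod z < 1 \<Longrightarrow> E n (\<gamma> z) = of_real (sqrt (c n)) * z ^ n"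
    using orthonormal_monomials by metis
  have EH: "E n \<in> H" for n using EC C(3) by auto
  define a where "a n = u n / of_real (sqrt (c n))" for n
  have "(cmod (a n))\<^sup>2 = (cmod (u n))\<^sup>2 / c n" for n
    using c_pos[of n] by (simp add: a_def norm_divide power_divide)
  then have "summable (\<lambda>n. (cmod (a n))\<^sup>2)" using u by simp
  then obtain g where g: "g \<in> H" "(\<lambda>n. ip_norm ip ((\<Sum>i<n. cscale (a i) (E i)) - g)) \<longlonglongrightarrow> 0"
    using orthonormal_series_converges[OF EH on] by blast
  have "(\<lambda>n. u n * z ^ n) sums g (\<gamma> z)" if z: "cmod z < 1" for z
  proof -
    have sH: "(\<Sum>i<n. cscale (a i) (E i)) \<in> H" for n by (intro H_closed EH)
    have "(\<lambda>n. ip (\<Sum>i<n. cscale (a i) (E i)) (ker z)) \<longlonglongrightarrow> ip g (ker z)"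
      by (intro tendsto_ip_left sH g ker_in z)
    moreover have "ip (\<Sum>i<n. cscale (a i) (E i)) (ker z) = (\<Sum>i<n. u i * z ^ i)" for n
    proof -
      have "a i * E i (\<gamma> z) = u i * z ^ i" for i
        using c_pos[of i] z by (simp add: a_def E_apply)
      then show ?thesis unfolding ip_ker[OF sH z] by simp
    qed
    ultimately show ?thesis using z g(1) by (simp add: sums_def ip_ker)
  qed
  moreover have "g \<in> closed_span H ip (kernel_fun X k ` \<gamma> ` ball 0 1)"
    by (rule closed_span_closed[OF S _ g])
      (intro cfun.subspace_sum[OF C(1)] cfun.subspace_scale[OF C(1)] EC)
  ultimately show ?thesis by blast
qed

section \<open>Renewal sequences\<close>

text \<open>
  If \<open>a k\<close> is the probability that the steps of a random walk on the natural numbers have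
  length \<open>k + 1\<close>, then \<open>renewal a n\<close> is the probability that the walk visits \<open>n\<close>.
\<close>

fun renewal :: "(nat \<Rightarrow> real) \<Rightarrow> nat \<Rightarrow> real" where
  "renewal a 0 = 1"
| "renewal a (Suc n) = (\<Sum>k\<le>n. a k * renewal a (n - k))"

lemma renewal_bounds:
  assumes a: "\<And>k. a k \<ge> 0" and a0: "a 0 > 0" and s: "summable a" "suminf a \<le> 1"
  shows "0 < renewal a n \<and> renewal a n \<le> 1"
proof (induction n rule: less_induct)
  case (less n)
  show ?case
  proof (cases n)
    case 0
    then show ?thesis by simp
  next
    case (Suc m)
    have "a 0 * renewal a m \<le> renewal a n"
      unfolding Suc renewal.simps using member_le_sum[of 0 "{..m}" "\<lambda>k. a k * renewal a (m - k)"] a less Suc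
      by (simp add: less_imp_le)
    moreover have "0 < a 0 * renewal a m" using a0 less Suc by simp
    moreover have "renewal a n \<le> (\<Sum>k\<le>m. a k * 1)"
      unfolding Suc renewal.simps using a less Suc by (intro sum_mono mult_left_mono) auto
    moreover have "(\<Sum>k\<le>m. a k * 1) \<le> 1"
      using sum_le_suminf[OF s(1), of "{..m}"] a s(2) by auto
    ultimately show ?thesis by linarith
  qed
qed

text \<open>
  A walk may visit \<open>m + n\<close> by first visiting \<open>m\<close> and then advancing by \<open>n\<close>.
\<close>

lemma renewal_supermultiplicative:
  assumes a: "\<And>k. a k \<ge> 0" and nonneg: "\<And>n. renewal a n \<ge> 0"
  shows "renewal a m * renewal a n \<le> renewal a (m + n)"
proof (induction m rule: less_induct)
  case (less m)
  show ?case
  proof (cases m)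
    case 0
    then show ?thesis by simp
  next
    case (Suc l)
    have "renewal a m * renewal a n = (\<Sum>k\<le>l. a k * (renewal a (l - k) * renewal a n))"
      unfolding Suc renewal.simps sum_distrib_right by (simp add: mult.assoc)
    also have "\<dots> \<le> (\<Sum>k\<le>l. a k * renewal a (l - k + n))"
    proof (intro sum_mono mult_left_mono a)
      show "renewal a (l - k) * renewal a n \<le> renewal a (l - k + n)" for k
        using less[of "l - k"] Suc by auto
    qed
    also have "\<dots> = (\<Sum>k\<le>l. a k * renewal a (l + n - k))"
      by (intro sum.cong) auto
    also have "\<dots> \<le> (\<Sum>k\<le>l + n. a k * renewal a (l + n - k))"
      using a nonneg by (intro sum_mono2) auto
    also have "\<dots> = renewal a (m + n)" unfolding Suc by simp
    finally show ?thesis .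
  qed
qed

text \<open>
  With \<open>C\<close> the sum on the left and \<open>A\<close> the power series of \<open>a\<close>, the recursion says
  \<open>C - 1 = t * (A * C)\<close>.
\<close>

lemma renewal_power_series:
  fixes t :: complex
  assumes a: "\<And>k. a k \<ge> 0" and a0: "a 0 > 0" and s: "summable a" "suminf a \<le> 1" and t: "cmod t < 1"
  shows "(\<lambda>n. of_real (renewal a n) * t ^ n) sums (1 / (1 - (\<Sum>k. of_real (a k) * t ^ Suc k)))"
proof -
  note rb = renewal_bounds[OF a a0 s]
  have a_le: "a k \<le> 1" for k using sum_le_suminf[OF s(1), of "{k}"] a s(2) by auto
  have geo: "summable (\<lambda>n. cmod t ^ n)" using t by simp
  have nc: "summable (\<lambda>n. norm (of_real (renewal a n) * t ^ n))"
  proof (rule summable_comparison_test'[OF geo, of 0])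
    fix n
    show "norm (norm (of_real (renewal a n) * t ^ n)) \<le> cmod t ^ n"
      using mult_right_mono[of "renewal a n" 1 "cmod t ^ n"] rb[of n] by (simp add: norm_mult norm_power)
  qed
  have na: "summable (\<lambda>n. norm (of_real (a n) * t ^ n))"
  proof (rule summable_comparison_test'[OF geo, of 0])
    fix n
    show "norm (norm (of_real (a n) * t ^ n)) \<le> cmod t ^ n"
      using mult_right_mono[OF a_le[of n], of "cmod t ^ n"] a[of n] by (simp add: norm_mult norm_power)
  qed
  define C where "C = (\<Sum>n. of_real (renewal a n) * t ^ n)"
  define A where "A = (\<Sum>n. of_real (a n) * t ^ n)"
  have "(\<lambda>n. \<Sum>i\<le>n. (of_real (a i) * t ^ i) * (of_real (renewal a (n - i)) * t ^ (n - i))) sums (A * C)"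
    unfolding A_def C_def by (rule Cauchy_product_sums[OF na nc])
  also have "(\<lambda>n. \<Sum>i\<le>n. (of_real (a i) * t ^ i) * (of_real (renewal a (n - i)) * t ^ (n - i)))
      = (\<lambda>n. of_real (renewal a (Suc n)) * t ^ n)"
  proof
    fix n
    have "(\<Sum>i\<le>n. (of_real (a i) * t ^ i) * (of_real (renewal a (n - i)) * t ^ (n - i)))
        = (\<Sum>i\<le>n. of_real (a i * renewal a (n - i)) * t ^ n)"
    proof (intro sum.cong refl)
      fix i assume "i \<in> {..n}"
      then have "t ^ n = t ^ i * t ^ (n - i)" by (simp flip: power_add)
      then show "(of_real (a i) * t ^ i) * (of_real (renewal a (n - i)) * t ^ (n - i))
          = of_real (a i * renewal a (n - i)) * t ^ n" by simp
    qed
    then show "(\<Sum>i\<le>n. (of_real (a i) * t ^ i) * (of_real (renewal a (n - i)) * t ^ (n - i)))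
        = of_real (renewal a (Suc n)) * t ^ n" by (simp add: sum_distrib_right)
  qed
  finally have "(\<lambda>n. of_real (renewal a (Suc n)) * t ^ Suc n) sums (t * (A * C))"
    using sums_mult[of "\<lambda>n. of_real (renewal a (Suc n)) * t ^ n" "A * C" t]
    by (simp only: power_Suc mult.left_commute)
  moreover have "(\<lambda>n. of_real (renewal a n) * t ^ n) sums C"
    unfolding C_def by (rule summable_sums[OF summable_norm_cancel[OF nc]])
  then have "(\<lambda>n. of_real (renewal a (Suc n)) * t ^ Suc n) sums (C - 1)"
    by (subst sums_Suc_iff) simp
  ultimately have "C - 1 = t * (A * C)" by (rule sums_unique2[rotated])
  then have "C * (1 - t * A) = 1" by (simp add: algebra_simps)
  moreover have "t * A = (\<Sum>k. of_real (a k) * t ^ Suc k)"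
    unfolding A_def suminf_mult[OF summable_norm_cancel[OF na], symmetric]
    by (simp only: power_Suc mult.left_commute)
  ultimately have "C = 1 / (1 - (\<Sum>k. of_real (a k) * t ^ Suc k))"
    by (metis mult_zero_right nonzero_eq_divide_eq zero_neq_one)
  then show ?thesis using \<open>_ sums C\<close> by simp
qed

text \<open>
  The last point visited up to \<open>n\<close> is \<open>n - k\<close> if the walk visits \<open>n - k\<close> and then makes a
  step longer than \<open>k\<close>, which has the tail probability \<open>1 - (\<Sum>j<k. a j)\<close>; these events
  exhaust all possibilities.
\<close>

lemma renewal_tail_identity:
  assumes s: "a sums 1"
  shows "(\<Sum>k\<le>n. (1 - (\<Sum>j<k. a j)) * renewal a (n - k)) = 1"
proof (induction n)
  case 0
  show ?case by simp
next
  case (Suc n)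
  let ?T = "\<lambda>k. 1 - (\<Sum>j<k. a j)"
  have "(\<Sum>k\<le>Suc n. ?T k * renewal a (Suc n - k)) = renewal a (Suc n) + (\<Sum>k\<le>n. ?T (Suc k) * renewal a (n - k))"
    by (subst sum.atMost_Suc_shift) simp
  also have "(\<Sum>k\<le>n. ?T (Suc k) * renewal a (n - k))
      = (\<Sum>k\<le>n. ?T k * renewal a (n - k)) - (\<Sum>k\<le>n. a k * renewal a (n - k))"
    unfolding sum_subtractf[symmetric] by (intro sum.cong) (auto simp: algebra_simps)
  finally show ?case using Suc by simp
qed

text \<open>
  The mean of a distribution on the positive integers is the sum of its tails, by partial
  summation.
\<close>

lemma summable_tail_iff:
  fixes a :: "nat \<Rightarrow> real"
  assumes a: "\<And>k. a k \<ge> 0" and s: "a sums 1"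
  shows "summable (\<lambda>k. 1 - (\<Sum>j<k. a j)) \<longleftrightarrow> summable (\<lambda>k. real (k + 1) * a k)"
proof -
  let ?T = "\<lambda>k. 1 - (\<Sum>j<k. a j)"
  have T_nonneg: "?T k \<ge> 0" for k
    using sum_le_suminf[of a "{..<k}"] a s by (auto simp: sums_iff)
  have abel: "(\<Sum>k<n. ?T k) = (\<Sum>k<n. real (k + 1) * a k) + real n * ?T n" for n
    by (induction n) (auto simp: algebra_simps)
  show ?thesis
  proof
    assume T: "summable ?T"
    show "summable (\<lambda>k. real (k + 1) * a k)"
    proof (rule summableI_nonneg_bounded)
      fix n
      have "(\<Sum>k<n. real (k + 1) * a k) \<le> (\<Sum>k<n. ?T k)" unfolding abel using T_nonneg[of n] by simp
      also have "\<dots> \<le> suminf ?T" using T T_nonneg by (intro sum_le_suminf) auto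
      finally show "(\<Sum>k<n. real (k + 1) * a k) \<le> suminf ?T" .
    qed (use a in auto)
  next
    assume m: "summable (\<lambda>k. real (k + 1) * a k)"
    show "summable ?T"
    proof (rule summableI_nonneg_bounded[OF T_nonneg])
      fix n
      have sa: "summable (\<lambda>k. a (k + n))" "summable (\<lambda>k. real (k + n + 1) * a (k + n))"
        using summable_ignore_initial_segment[of a n] summable_ignore_initial_segment[OF m, of n] s
        by (auto simp: sums_iff)
      have "?T n = (\<Sum>k. a (k + n))"
        using suminf_split_initial_segment[of a n] s by (simp add: sums_iff)
      then have "real n * ?T n = (\<Sum>k. real n * a (k + n))"
        using suminf_mult[OF sa(1), of "real n"] by simp
      also have "\<dots> \<le> (\<Sum>k. real (k + n + 1) * a (k + n))"
        using sa a by (intro suminf_le summable_mult mult_right_mono) auto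
      finally have "(\<Sum>k<n. ?T k) \<le> (\<Sum>k. real (k + 1) * a k)"
        unfolding abel suminf_split_initial_segment[OF m, of n] by simp
      then show "(\<Sum>k<n. ?T k) \<le> (\<Sum>k. real (k + 1) * a k)" .
    qed
  qed
qed

text \<open>
  A weak form of the renewal theorem: the visiting probabilities stay away from \<open>0\<close> if and
  only if the mean step length is finite. Both directions read off the tail identity. A lower bound
  \<open>\<delta>\<close> for \<open>renewal a\<close> gives the bound \<open>1 / \<delta>\<close> for the sum of the tails. Conversely, if the
  sum \<open>\<mu>\<close> of the tails is finite and the tails from \<open>K\<close> on have sum less than \<open>1/2\<close>, then
  some point among the last \<open>K + 1\<close> is visited with probability at least \<open>1 / (2 * \<mu>)\<close>, and
  from there the walk reaches \<open>n\<close> by at most \<open>K\<close> steps of length \<open>1\<close>.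
\<close>

lemma renewal_bounded_below_iff:
  assumes a: "\<And>k. a k \<ge> 0" and a0: "a 0 > 0" and s: "a sums 1"
  shows "(\<exists>\<delta>>0. \<forall>n. \<delta> \<le> renewal a n) \<longleftrightarrow> summable (\<lambda>k. real (k + 1) * a k)"
proof -
  let ?T = "\<lambda>k. 1 - (\<Sum>j<k. a j)"
  have s': "summable a" "suminf a \<le> 1" using s by (auto simp: sums_iff)
  note rb = renewal_bounds[OF a a0 s']
  have T_nonneg: "?T k \<ge> 0" for k
    using sum_le_suminf[of a "{..<k}"] a s by (auto simp: sums_iff)
  show ?thesis unfolding summable_tail_iff[OF a s, symmetric]
  proof
    assume "\<exists>\<delta>>0. \<forall>n. \<delta> \<le> renewal a n"
    then obtain \<delta> where \<delta>: "\<delta> > 0" "\<And>n. \<delta> \<le> renewal a n" by blast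
    show "summable ?T"
    proof (rule summableI_nonneg_bounded[OF T_nonneg])
      fix n
      have "\<delta> * (\<Sum>k<n. ?T k) \<le> \<delta> * (\<Sum>k\<le>n. ?T k)"
        using \<delta>(1) T_nonneg by (intro mult_left_mono sum_mono2) auto
      also have "\<dots> \<le> (\<Sum>k\<le>n. ?T k * renewal a (n - k))"
        unfolding sum_distrib_left mult.commute[of \<delta>] using T_nonneg \<delta>(2) by (intro sum_mono mult_left_mono)
      also have "\<dots> = 1" by (rule renewal_tail_identity[OF s])
      finally show "(\<Sum>k<n. ?T k) \<le> 1 / \<delta>" using \<delta>(1) by (simp add: field_simps)
    qed
  next
    assume T: "summable ?T"
    define \<mu> where "\<mu> = suminf ?T"
    have "\<mu> \<ge> (\<Sum>k<1. ?T k)" unfolding \<mu>_def using T T_nonneg by (intro sum_le_suminf) auto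
    then have \<mu>: "\<mu> \<ge> 1" by simp
    obtain K where K: "\<And>n. norm (\<Sum>k=K..<n. ?T k) < 1/2"
      using T unfolding summable_Cauchy by (metis half_gt_zero_iff order_refl zero_less_one)
    have a0_le: "a 0 \<le> 1" using sum_le_suminf[OF s'(1), of "{0}"] a s'(2) by auto
    define \<delta> where "\<delta> = a 0 ^ K / (2 * \<mu>)"
    have "\<delta> \<le> renewal a n" for n
    proof -
      \<comment> \<open>Otherwise the summands with \<open>k < K\<close> of the tail identity contribute at most \<open>1/2\<close>, and
         those with \<open>k \<ge> K\<close> less than \<open>1/2\<close>.\<close>
      have "\<exists>j\<le>n. n - j < Suc K \<and> 1 / (2 * \<mu>) \<le> renewal a j"
      proof (rule ccontr)
        assume "\<not> ?thesis"
        then have small: "renewal a (n - k) \<le> 1 / (2 * \<mu>)" if "k < Suc K" "k \<le> n" for k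
          using that by (metis diff_diff_cancel diff_le_self linorder_not_less less_imp_le)
        have "1 = (\<Sum>k\<le>n. ?T k * renewal a (n - k))" using renewal_tail_identity[OF s] by simp
        also have "\<dots> \<le> (\<Sum>k\<le>n. ?T k * (if k < K then 1 / (2 * \<mu>) else 1))"
          using small rb T_nonneg by (intro sum_mono mult_left_mono) auto
        also have "\<dots> = (\<Sum>k\<in>{..n} \<inter> {..<K}. ?T k * (1 / (2 * \<mu>))) + (\<Sum>k\<in>{K..<Suc n}. ?T k)"
        proof -
          have "(\<Sum>k\<le>n. T k * (if k < K then x else 1))
              = (\<Sum>k\<in>{..n} \<inter> {..<K}. T k * x) + (\<Sum>k\<in>{K..<Suc n}. T k)" for T :: "nat \<Rightarrow> real" and x
          proof -
            have "{..n} = ({..n} \<inter> {..<K}) \<union> {K..<Suc n}" by auto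
            then have "(\<Sum>k\<le>n. T k * (if k < K then x else 1))
                = (\<Sum>k\<in>({..n} \<inter> {..<K}) \<union> {K..<Suc n}. T k * (if k < K then x else 1))" by (rule sum.cong) simp
            also have "\<dots> = (\<Sum>k\<in>{..n} \<inter> {..<K}. T k * (if k < K then x else 1))
                + (\<Sum>k\<in>{K..<Suc n}. T k * (if k < K then x else 1))" by (rule sum.union_disjoint) auto
            finally show ?thesis by simp
          qed
          then show ?thesis .
        qed
        also have "(\<Sum>k\<in>{..n} \<inter> {..<K}. ?T k * (1 / (2 * \<mu>))) \<le> \<mu> * (1 / (2 * \<mu>))"
          unfolding sum_distrib_right[symmetric] using \<mu> T T_nonneg unfolding \<mu>_def
          by (intro mult_right_mono sum_le_suminf) auto
        also have "\<mu> * (1 / (2 * \<mu>)) = 1/2" using \<mu> by simp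
        also have "(\<Sum>k\<in>{K..<Suc n}. ?T k) < 1/2" using K[of "Suc n"] by (simp only: real_norm_def abs_less_iff)
        finally show False by simp
      qed
      then obtain j where j: "j \<le> n" "n - j \<le> K" "1 / (2 * \<mu>) \<le> renewal a j" by auto
      have step: "a 0 ^ d \<le> renewal a d" for d
      proof (induction d)
        case (Suc d)
        have "a 0 * renewal a d \<le> renewal a (Suc d)"
          unfolding renewal.simps using member_le_sum[of 0 "{..d}" "\<lambda>k. a k * renewal a (d - k)"] a rb
          by (simp add: less_imp_le)
        then show ?case using Suc a0 by (simp add: order_trans[OF mult_left_mono])
      qed simp
      have "a 0 ^ K * (1 / (2 * \<mu>)) \<le> renewal a (n - j) * renewal a j"
        using j a0 a0_le \<mu> rb less_imp_le order_trans[OF power_decreasing[OF j(2)] step]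
        by (intro mult_mono) auto
      also have "\<dots> \<le> renewal a (n - j + j)"
        using rb by (intro renewal_supermultiplicative a less_imp_le) auto
      finally show ?thesis using j(1) by (simp add: \<delta>_def)
    qed
    moreover have "\<delta> > 0" using a0 \<mu> by (simp add: \<delta>_def)
    ultimately show "\<exists>\<delta>>0. \<forall>n. \<delta> \<le> renewal a n" by blast
  qed
qed

text \<open>
  If \<open>renewal a m < r ^ m\<close> for all \<open>m > 0\<close>, then the renewal sequence has a finite sum
  \<open>s\<close>, and summing the recursion over all \<open>n\<close> gives \<open>s - 1 = s\<close>. So \<open>renewal a m \<ge> r ^ m\<close> for
  some \<open>m > 0\<close>, and supermultiplicativity extends this to all exponents up to a factor that
  accounts for the residues modulo \<open>m\<close>.
\<close>

lemma renewal_subexponential: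
  assumes a: "\<And>k. a k \<ge> 0" and a0: "a 0 > 0" and s: "a sums 1" and r: "0 < r" "r < 1"
  shows "\<exists>\<delta>>0. \<forall>n. \<delta> * r ^ n \<le> renewal a n"
proof -
  have s': "summable a" "suminf a \<le> 1" using s by (auto simp: sums_iff)
  note rb = renewal_bounds[OF a a0 s']
  have "\<exists>m>0. r ^ m \<le> renewal a m"
  proof (rule ccontr)
    assume neg: "\<not> ?thesis"
    have c_le: "renewal a n \<le> r ^ n" for n
    proof -
      have "n = 0 \<or> renewal a n < r ^ n" using neg by (auto simp: not_le)
      then show ?thesis by auto
    qed
    have c: "summable (renewal a)"
      by (rule summable_comparison_test'[of "\<lambda>n. r ^ n" 0]) (use r c_le rb less_imp_le in \<open>auto simp: abs_of_pos\<close>)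
    have "(\<lambda>n. \<Sum>i\<le>n. a i * renewal a (n - i)) sums (suminf a * suminf (renewal a))"
      using a rb c s' less_imp_le by (intro Cauchy_product_sums) (auto simp: abs_of_pos)
    then have "(\<lambda>n. renewal a (Suc n)) sums suminf (renewal a)" using s by (simp add: sums_iff)
    moreover have "(\<lambda>n. renewal a (Suc n)) sums (suminf (renewal a) - 1)"
      using c by (subst sums_Suc_iff) auto
    ultimately have "suminf (renewal a) = suminf (renewal a) - 1" by (rule sums_unique2)
    then show False by simp
  qed
  then obtain m where m: "m > 0" "r ^ m \<le> renewal a m" by blast
  define \<delta> where "\<delta> = Min (renewal a ` {..<m})"
  have \<delta>: "\<delta> > 0" unfolding \<delta>_def using m(1) rb by (subst Min_gr_iff) auto
  have "\<delta> * r ^ n \<le> renewal a n" for n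
  proof (induction n rule: less_induct)
    case (less n)
    show ?case
    proof (cases "n < m")
      case True
      have "\<delta> * r ^ n \<le> \<delta> * 1" using \<delta> r by (intro mult_left_mono power_le_one) auto
      also have "\<dots> \<le> renewal a n" unfolding \<delta>_def using True by auto
      finally show ?thesis .
    next
      case False
      have "\<delta> * r ^ n = r ^ m * (\<delta> * r ^ (n - m))" using False by (simp flip: power_add)
      also have "\<dots> \<le> renewal a m * renewal a (n - m)"
        using False m less[of "n - m"] r \<delta> rb less_imp_le by (intro mult_mono) auto
      also have "\<dots> \<le> renewal a (m + (n - m))"
        using rb less_imp_le by (intro renewal_supermultiplicative a) auto
      finally show ?thesis using False by simp
    qed
  qed
  then show ?thesis using \<delta> by blast
qed

section \<open>Isomorphisms with the algebra of bounded analytic functions\<close>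

lemma restrict0_in_functions_on: "restrict0 X f \<in> functions_on X"
  by (simp add: restrict0_def functions_on_def)

lemma functions_on_eqI:
  "f \<in> functions_on X \<Longrightarrow> g \<in> functions_on X \<Longrightarrow> (\<And>x. x \<in> X \<Longrightarrow> f x = g x) \<Longrightarrow> f = g"
  by (auto simp: functions_on_def fun_eq_iff) metis

lemma algebra_isomorphic_trans:
  assumes "algebra_isomorphic A B" "algebra_isomorphic B C" shows "algebra_isomorphic A C"
proof -
  obtain T where T: "bij_betw T A B" "\<And>f g. f \<in> A \<Longrightarrow> g \<in> A \<Longrightarrow> T (f + g) = T f + T g"
    "\<And>f g. f \<in> A \<Longrightarrow> g \<in> A \<Longrightarrow> T (f * g) = T f * T g" "\<And>c f. f \<in> A \<Longrightarrow> T (cscale c f) = cscale c (T f)"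
    using assms(1) unfolding algebra_isomorphic_def by blast
  obtain S where S: "bij_betw S B C" "\<And>f g. f \<in> B \<Longrightarrow> g \<in> B \<Longrightarrow> S (f + g) = S f + S g"
    "\<And>f g. f \<in> B \<Longrightarrow> g \<in> B \<Longrightarrow> S (f * g) = S f * S g" "\<And>c f. f \<in> B \<Longrightarrow> S (cscale c f) = cscale c (S f)"
    using assms(2) unfolding algebra_isomorphic_def by blast
  have TB: "T f \<in> B" if "f \<in> A" for f using T(1) that by (auto simp: bij_betw_def)
  show ?thesis unfolding algebra_isomorphic_def
    using bij_betw_trans[OF T(1) S(1)] T S TB by (intro exI[of _ "S \<circ> T"]) auto
qed

text \<open>
  The hypotheses are symmetric in the two spaces, so that the lemma also gives the isomorphism in
  the opposite direction.
\<close>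

lemma algebra_isomorphic_multiplier_algebra_reparam:
  assumes f: "\<And>x. x \<in> X \<Longrightarrow> f x \<in> Y" "\<And>x. x \<in> X \<Longrightarrow> f' (f x) = x"
    and f': "\<And>y. y \<in> Y \<Longrightarrow> f' y \<in> X" "\<And>y. y \<in> Y \<Longrightarrow> f (f' y) = y"
    and F: "F \<subseteq> functions_on X" "\<And>g. g \<in> F \<Longrightarrow> restrict0 Y (g \<circ> f') \<in> G"
    and G: "G \<subseteq> functions_on Y" "\<And>g. g \<in> G \<Longrightarrow> restrict0 X (g \<circ> f) \<in> F"
  shows "algebra_isomorphic (multiplier_algebra X F) (multiplier_algebra Y G)"
proof -
  let ?T = "\<lambda>\<phi>. restrict0 Y (\<phi> \<circ> f')" and ?S = "\<lambda>\<phi>. restrict0 X (\<phi> \<circ> f)"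
  have T: "?T \<phi> \<in> multiplier_algebra Y G" if "\<phi> \<in> multiplier_algebra X F" for \<phi>
  proof -
    have "?T \<phi> * g \<in> G" if "g \<in> G" for g
    proof -
      have "?T (\<phi> * ?S g) = ?T \<phi> * g"
        using G(1) that f f' by (auto simp: restrict0_def functions_on_def fun_eq_iff)
      then show ?thesis using F(2)[of "\<phi> * ?S g"] G(2)[OF that] \<open>\<phi> \<in> _\<close>
        by (auto simp: multiplier_algebra_def)
    qed
    then show ?thesis by (simp add: multiplier_algebra_def restrict0_in_functions_on)
  qed
  have S: "?S \<phi> \<in> multiplier_algebra X F" if "\<phi> \<in> multiplier_algebra Y G" for \<phi>
  proof -
    have "?S \<phi> * g \<in> F" if "g \<in> F" for g
    proof -
      have "?S (\<phi> * ?T g) = ?S \<phi> * g"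
        using F(1) that f f' by (auto simp: restrict0_def functions_on_def fun_eq_iff)
      then show ?thesis using G(2)[of "\<phi> * ?T g"] F(2)[OF that] \<open>\<phi> \<in> _\<close>
        by (auto simp: multiplier_algebra_def)
    qed
    then show ?thesis by (simp add: multiplier_algebra_def restrict0_in_functions_on)
  qed
  have ST: "?S (?T \<phi>) = \<phi>" if "\<phi> \<in> multiplier_algebra X F" for \<phi>
    using that f by (auto simp: multiplier_algebra_def restrict0_def functions_on_def fun_eq_iff)
  have TS: "?T (?S \<phi>) = \<phi>" if "\<phi> \<in> multiplier_algebra Y G" for \<phi>
    using that f' by (auto simp: multiplier_algebra_def restrict0_def functions_on_def fun_eq_iff)
  have "bij_betw ?T (multiplier_algebra X F) (multiplier_algebra Y G)"
    by (rule bij_betw_byWitness[of _ ?S]) (use T S ST TS in auto)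
  then show ?thesis unfolding algebra_isomorphic_def
    by (intro exI[of _ ?T]) (auto simp: restrict0_def fun_eq_iff)
qed

lemma H_inftyI:
  assumes "f \<in> functions_on (ball 0 1)" "f holomorphic_on ball 0 1" "\<And>z. cmod z < 1 \<Longrightarrow> cmod (f z) \<le> B"
  shows "f \<in> H_infty"
proof -
  have "bounded (f ` ball 0 1)" unfolding bounded_iff using assms(3) by (intro exI[of _ B]) auto
  then show ?thesis using assms by (simp add: H_infty_def)
qed

lemma H_infty_bounded:
  assumes "g \<in> H_infty" obtains B where "\<And>z. cmod z < 1 \<Longrightarrow> cmod (g z) \<le> B"
proof -
  obtain B where "\<forall>x\<in>g ` ball 0 1. cmod x \<le> B"
    using assms unfolding H_infty_def bounded_iff by blast
  then show ?thesis using that by (metis image_eqI mem_ball_0)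
qed

lemma H_infty_restrict0I:
  assumes "f holomorphic_on ball 0 1" "\<And>z. cmod z < 1 \<Longrightarrow> cmod (f z) \<le> B"
  shows "restrict0 (ball 0 1) f \<in> H_infty"
proof (rule H_inftyI)
  show "restrict0 (ball 0 1) f holomorphic_on ball 0 1"
    using assms(1) by (rule holomorphic_transform) (simp add: restrict0_def)
qed (use assms in \<open>auto simp: restrict0_def functions_on_def\<close>)

text \<open>
  The difference quotient is analytic by removal of the singularity at \<open>a\<close>. It is bounded
  near \<open>a\<close> by continuity and elsewhere because \<open>\<bar>z - a\<bar>\<close> is bounded below.
\<close>

lemma H_infty_division:
  assumes g: "g \<in> H_infty" and a: "cmod a < 1"
  shows "\<exists>q\<in>H_infty. \<forall>z. cmod z < 1 \<longrightarrow> g z - g a = (z - a) * q z"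
proof -
  define q where "q z = (if z = a then deriv g a else (g z - g a) / (z - a))" for z
  have g': "g holomorphic_on ball 0 1" "bounded (g ` ball 0 1)" using g by (auto simp: H_infty_def)
  have hol: "q holomorphic_on ball 0 1"
    unfolding q_def by (rule pole_lemma_open[OF g'(1)]) auto
  obtain B where B: "\<And>z. cmod z < 1 \<Longrightarrow> cmod (g z) \<le> B" using H_infty_bounded[OF g] by blast
  define r where "r = (1 - cmod a) / 2"
  have r: "r > 0" using a by (simp add: r_def)
  have sub: "cball a r \<subseteq> ball 0 1"
  proof
    fix z assume "z \<in> cball a r"
    then have "cmod (z - a) \<le> r" by (simp add: dist_norm norm_minus_commute)
    then have "cmod z \<le> r + cmod a" using norm_triangle_sub[of z a] by simp
    then show "z \<in> ball 0 1" using a by (simp add: r_def field_simps)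
  qed
  have "bounded (q ` cball a r)"
    by (intro compact_imp_bounded compact_continuous_image holomorphic_on_imp_continuous_on
        holomorphic_on_subset[OF hol sub]) auto
  then obtain C where C: "\<And>z. z \<in> cball a r \<Longrightarrow> cmod (q z) \<le> C" unfolding bounded_iff by blast
  have "cmod (q z) \<le> max C (2 * B / r)" if z: "cmod z < 1" for z
  proof (cases "z \<in> cball a r")
    case False
    then have far: "cmod (z - a) > r" by (simp add: dist_norm norm_minus_commute)
    have "cmod (g z - g a) \<le> 2 * B" using norm_triangle_ineq4[of "g z" "g a"] B[OF z] B[OF a] by simp
    then have "cmod (q z) \<le> 2 * B / r"
      using far r unfolding q_def by (auto simp: norm_divide intro!: frac_le order_trans[OF norm_ge_zero])
    then show ?thesis by simp
  qed (use C in \<open>auto simp: le_max_iff_disj\<close>)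
  then have "restrict0 (ball 0 1) q \<in> H_infty" by (rule H_infty_restrict0I[OF hol])
  moreover have "g z - g a = (z - a) * restrict0 (ball 0 1) q z" if "cmod z < 1" for z
    using that by (simp add: restrict0_def q_def)
  ultimately show ?thesis by blast
qed

lemma unimodular_value_imp_constant:
  assumes h: "h holomorphic_on ball 0 1" and le: "\<And>z. cmod z < 1 \<Longrightarrow> cmod (h z) \<le> 1"
    and w: "cmod w < 1" "\<not> cmod (h w) < 1"
  shows "cmod (h w) = 1" and "cmod z < 1 \<Longrightarrow> h z = h w"
proof -
  show 1: "cmod (h w) = 1" using le[OF w(1)] w(2) by simp
  have "h constant_on ball 0 1"
    by (rule maximum_modulus_principle[OF h, of "ball 0 1" w]) (use w le 1 in auto)
  then show "h z = h w" if "cmod z < 1" using that w unfolding constant_on_def by (metis mem_ball_0)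
qed

text \<open>
  Let \<open>S\<close> be the inverse of the isomorphism \<open>T\<close>, and let \<open>h = S z\<close>, where \<open>z\<close> is the
  coordinate function. For \<open>w\<close> in the disc, \<open>g \<mapsto> S g w\<close> is a character of \<open>H_infty\<close> with value
  \<open>h w\<close> at \<open>z\<close>. Invertibility of \<open>z - \<alpha>\<close> for \<open>\<bar>\<alpha>\<bar> > 1\<close> shows \<open>\<bar>h w\<bar> \<le> 1\<close>, and the maximum
  principle excludes equality, because \<open>h\<close> is not constant. Since \<open>z - h w\<close> divides
  \<open>g - g (h w)\<close> in \<open>H_infty\<close>, the character is evaluation at \<open>h w\<close>, that is, \<open>S g = g \<circ> h\<close>.

  The resolvents of \<open>z\<close> in \<open>A\<close> show in the same way that \<open>g0 = T z\<close> maps the disc to itself,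
  and \<open>g0 \<circ> h = S g0 = z\<close>. So each \<open>\<phi> \<in> H_infty\<close> equals \<open>\<phi> \<circ> g0 \<circ> h = S (\<phi> \<circ> g0) \<in> A\<close>.
\<close>

lemma H_infty_subset_of_isomorphic_algebra:
  fixes A :: "(complex \<Rightarrow> complex) set"
  defines "D \<equiv> ball (0::complex) 1"
  assumes A: "A \<subseteq> functions_on D" "\<And>\<phi>. \<phi> \<in> A \<Longrightarrow> \<phi> holomorphic_on D"
    and A_add: "\<And>\<phi> \<psi>. \<phi> \<in> A \<Longrightarrow> \<psi> \<in> A \<Longrightarrow> \<phi> + \<psi> \<in> A"
    and A_mult: "\<And>\<phi> \<psi>. \<phi> \<in> A \<Longrightarrow> \<psi> \<in> A \<Longrightarrow> \<phi> * \<psi> \<in> A"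
    and A_scale: "\<And>c \<phi>. \<phi> \<in> A \<Longrightarrow> cscale c \<phi> \<in> A"
    and one: "restrict0 D (\<lambda>_. 1) \<in> A" and ident: "restrict0 D (\<lambda>z. z) \<in> A"
    and resolvent: "\<And>\<alpha>. 1 < cmod \<alpha> \<Longrightarrow> restrict0 D (\<lambda>z. 1 / (z - \<alpha>)) \<in> A"
    and iso: "algebra_isomorphic A H_infty"
  shows "H_infty \<subseteq> A"
proof -
  obtain T where T: "bij_betw T A H_infty"
    and T_add: "\<And>f g. f \<in> A \<Longrightarrow> g \<in> A \<Longrightarrow> T (f + g) = T f + T g"
    and T_mult: "\<And>f g. f \<in> A \<Longrightarrow> g \<in> A \<Longrightarrow> T (f * g) = T f * T g"
    and T_scale: "\<And>c f. f \<in> A \<Longrightarrow> T (cscale c f) = cscale c (T f)"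
    using iso unfolding algebra_isomorphic_def by blast
  define S where "S = inv_into A T"
  have TH: "T \<phi> \<in> H_infty" if "\<phi> \<in> A" for \<phi> using T that by (auto simp: bij_betw_def)
  have SA: "S g \<in> A" if "g \<in> H_infty" for g
    unfolding S_def using T that by (metis bij_betw_def inv_into_into)
  have TS: "T (S g) = g" if "g \<in> H_infty" for g
    unfolding S_def using T that by (metis bij_betw_def f_inv_into_f)
  have ST: "S (T \<phi>) = \<phi>" if "\<phi> \<in> A" for \<phi>
    unfolding S_def using T that by (simp add: bij_betw_def)
  have S_add: "S (f + g) = S f + S g" if "f \<in> H_infty" "g \<in> H_infty" for f g
    using ST[OF A_add[OF SA SA, OF that]] that by (simp add: T_add SA TS)
  have S_mult: "S (f * g) = S f * S g" if "f \<in> H_infty" "g \<in> H_infty" for f g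
    using ST[OF A_mult[OF SA SA, OF that]] that by (simp add: T_mult SA TS)
  have S_scale: "S (cscale c f) = cscale c (S f)" if "f \<in> H_infty" for c f
    using ST[OF A_scale[OF SA, OF that]] that by (simp add: T_scale SA TS)
  have H_add: "f + g \<in> H_infty" if "f \<in> H_infty" "g \<in> H_infty" for f g
    using TH[OF A_add[OF SA SA, OF that]] that by (simp add: T_add SA TS)
  have H_scale: "cscale c f \<in> H_infty" if "f \<in> H_infty" for c f
    using TH[OF A_scale[OF SA, OF that]] that by (simp add: T_scale SA TS)
  define u where "u = restrict0 D (\<lambda>_. 1)"
  define \<iota> where "\<iota> = restrict0 D (\<lambda>z. z)"
  have uA: "u \<in> A" and \<iota>A: "\<iota> \<in> A" using one ident by (simp_all add: u_def \<iota>_def)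
  have uH: "u \<in> H_infty" unfolding u_def D_def by (rule H_infty_restrict0I[of _ 1]) auto
  have \<iota>H: "\<iota> \<in> H_infty" unfolding \<iota>_def D_def by (rule H_infty_restrict0I[of _ 1]) (auto intro: holomorphic_intros)
  have H_on: "H_infty \<subseteq> functions_on D" by (auto simp: H_infty_def D_def)
  have u_mult: "u * f = f" if "f \<in> functions_on D" for f
    using that by (auto simp: u_def restrict0_def functions_on_def fun_eq_iff)
  have u_mult': "f * u = f" if "f \<in> functions_on D" for f
    using u_mult[OF that] by (simp add: mult.commute)
  have Su: "S u = u"
  proof -
    have "S u * u = S u * S (T u)" by (simp add: ST uA)
    also have "\<dots> = S (u * T u)" by (simp add: S_mult uH TH uA)
    also have "\<dots> = u" using u_mult[of "T u"] TH[OF uA] H_on by (auto simp: ST uA)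
    finally show ?thesis using u_mult'[of "S u"] SA[OF uH] A(1) by auto
  qed
  then have Tu: "T u = u" using TS[OF uH] by simp
  have u_apply: "u z = 1" if "cmod z < 1" for z using that by (simp add: u_def D_def restrict0_def)
  have \<iota>_apply: "\<iota> z = z" if "cmod z < 1" for z using that by (simp add: \<iota>_def D_def restrict0_def)
  define h where "h = S \<iota>"
  define g0 where "g0 = T \<iota>"
  \<comment> \<open>Divisibility by \<open>z - \<alpha>\<close>, written with the operations that \<open>S\<close> and \<open>T\<close> respect.\<close>
  have factor: "g + cscale (- \<beta>) u = (\<iota> + cscale (- \<alpha>) u) * q"
    if "g \<in> functions_on D" "\<And>z. cmod z < 1 \<Longrightarrow> g z - \<beta> = (z - \<alpha>) * q z" for g q \<alpha> \<beta>
    using that by (auto simp: fun_eq_iff functions_on_def u_def \<iota>_def restrict0_def D_def)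
  have S_factor: "S g w - \<beta> = (h w - \<alpha>) * S q w"
    if "g \<in> H_infty" "q \<in> H_infty" "\<And>z. cmod z < 1 \<Longrightarrow> g z - \<beta> = (z - \<alpha>) * q z" "cmod w < 1" for g q \<alpha> \<beta> w
  proof -
    have "S g + cscale (- \<beta>) u = (h + cscale (- \<alpha>) u) * S q"
      using arg_cong[OF factor[of g \<beta> \<alpha> q], of S] that H_on
      by (auto simp: S_add S_mult S_scale uH \<iota>H H_add H_scale Su h_def)
    from fun_cong[OF this, of w] show ?thesis using that(4) by (simp add: u_apply)
  qed
  have T_factor: "T \<phi> w - \<beta> = (g0 w - \<alpha>) * T q w"
    if "\<phi> \<in> A" "q \<in> A" "\<And>z. cmod z < 1 \<Longrightarrow> \<phi> z - \<beta> = (z - \<alpha>) * q z" "cmod w < 1" for \<phi> q \<alpha> \<beta> w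
  proof -
    have "T \<phi> + cscale (- \<beta>) u = (g0 + cscale (- \<alpha>) u) * T q"
      using arg_cong[OF factor[of \<phi> \<beta> \<alpha> q], of T] that A(1)
      by (auto simp: T_add T_mult T_scale uA \<iota>A A_add A_scale Tu g0_def)
    from fun_cong[OF this, of w] show ?thesis using that(4) by (simp add: u_apply)
  qed
  have resolvent_H: "restrict0 D (\<lambda>z. 1 / (z - \<alpha>)) \<in> H_infty" if \<alpha>: "1 < cmod \<alpha>" for \<alpha>
    unfolding D_def
  proof (rule H_infty_restrict0I)
    show "(\<lambda>z. 1 / (z - \<alpha>)) holomorphic_on ball 0 1" using \<alpha> by (auto intro!: holomorphic_intros)
    fix z :: complex assume "cmod z < 1"
    then have "cmod \<alpha> - 1 \<le> cmod (z - \<alpha>)" using norm_triangle_ineq2[of \<alpha> z] by (simp add: norm_minus_commute)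
    then show "cmod (1 / (z - \<alpha>)) \<le> 1 / (cmod \<alpha> - 1)" using \<alpha> by (auto simp: norm_divide intro!: divide_left_mono mult_pos_pos)
  qed
  have resolvent_eq: "u z - 0 = (z - \<alpha>) * restrict0 D (\<lambda>z. 1 / (z - \<alpha>)) z"
    if "1 < cmod \<alpha>" "cmod z < 1" for z \<alpha>
    using that by (auto simp: u_apply restrict0_def D_def)
  have h_hol: "h holomorphic_on ball 0 1" using A(2)[OF SA[OF \<iota>H]] by (simp add: h_def D_def)
  have g0H: "g0 \<in> H_infty" unfolding g0_def by (rule TH[OF \<iota>A])
  have g0_hol: "g0 holomorphic_on ball 0 1" using g0H by (simp add: H_infty_def)
  have h_le: "cmod (h w) \<le> 1" if "cmod w < 1" for w
  proof (rule ccontr)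
    assume neg: "\<not> cmod (h w) \<le> 1"
    then have "S u w - 0 = (h w - h w) * S (restrict0 D (\<lambda>z. 1 / (z - h w))) w"
      by (intro S_factor uH resolvent_H resolvent_eq that) auto
    then show False using that by (simp add: Su u_apply)
  qed
  have h_less: "cmod (h w) < 1" if "cmod w < 1" for w
  proof (rule ccontr)
    assume "\<not> cmod (h w) < 1"
    then have const: "cmod (h w) = 1" "\<And>z. cmod z < 1 \<Longrightarrow> h z = h w"
      using unimodular_value_imp_constant[OF h_hol _ that] h_le by blast+
    have "h = cscale (h w) u"
      using const(2) SA[OF \<iota>H] A(1)
      by (intro functions_on_eqI[of _ D]) (auto simp: h_def[symmetric] D_def u_def restrict0_def functions_on_def)
    then have "\<iota> = cscale (h w) u" using TS[OF \<iota>H] T_scale[OF uA] by (metis h_def Tu)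
    from fun_cong[OF this, of 0] show False using const(1) by (simp add: u_apply \<iota>_apply)
  qed
  have S_apply: "S g w = g (h w)" if g: "g \<in> H_infty" and w: "cmod w < 1" for g w
  proof -
    obtain q where "q \<in> H_infty" "\<And>z. cmod z < 1 \<Longrightarrow> g z - g (h w) = (z - h w) * q z"
      using H_infty_division[OF g h_less[OF w]] by blast
    from S_factor[OF g this w] show ?thesis by simp
  qed
  have g0_h: "g0 (h w) = w" if "cmod w < 1" for w
    using S_apply[OF g0H that] ST[OF \<iota>A] that by (simp add: g0_def \<iota>_apply)
  have g0_le: "cmod (g0 w) \<le> 1" if "cmod w < 1" for w
  proof (rule ccontr)
    assume neg: "\<not> cmod (g0 w) \<le> 1"
    then have "T u w - 0 = (g0 w - g0 w) * T (restrict0 D (\<lambda>z. 1 / (z - g0 w))) w"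
      by (intro T_factor uA resolvent resolvent_eq that) auto
    then show False using that by (simp add: Tu u_apply)
  qed
  have g0_less: "cmod (g0 w) < 1" if "cmod w < 1" for w
  proof (rule ccontr)
    assume "\<not> cmod (g0 w) < 1"
    then have const: "cmod (g0 w) = 1" "\<And>z. cmod z < 1 \<Longrightarrow> g0 z = g0 w"
      using unimodular_value_imp_constant[OF g0_hol _ that] g0_le by blast+
    show False using const(1) const(2)[OF h_less[of 0]] g0_h[of 0] by simp
  qed
  show "H_infty \<subseteq> A"
  proof
    fix \<phi> assume \<phi>: "\<phi> \<in> H_infty"
    obtain B where B: "\<And>z. cmod z < 1 \<Longrightarrow> cmod (\<phi> z) \<le> B" using H_infty_bounded[OF \<phi>] by blast
    have comp: "restrict0 D (\<phi> \<circ> g0) \<in> H_infty" unfolding D_def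
    proof (rule H_infty_restrict0I)
      show "\<phi> \<circ> g0 holomorphic_on ball 0 1"
        using \<phi> g0_less by (intro holomorphic_on_compose_gen[OF g0_hol, of _ "ball 0 1"]) (auto simp: H_infty_def)
    qed (use B g0_less in auto)
    have "S (restrict0 D (\<phi> \<circ> g0)) = \<phi>"
    proof (rule functions_on_eqI[of _ D])
      show "S (restrict0 D (\<phi> \<circ> g0)) \<in> functions_on D" using SA[OF comp] A(1) by auto
      show "\<phi> \<in> functions_on D" using \<phi> H_on by auto
      show "S (restrict0 D (\<phi> \<circ> g0)) w = \<phi> w" if "w \<in> D" for w
        using that h_less S_apply[OF comp, of w] by (simp add: D_def restrict0_def g0_h)
    qed
    then show "\<phi> \<in> A" using SA[OF comp] by simp
  qed
qed

section \<open>Weighted Hardy spaces\<close>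

text \<open>
  For \<open>c = (\<lambda>_. 1)\<close> this is the classical Hardy space on the disc.
\<close>

definition weighted_hardy :: "(nat \<Rightarrow> real) \<Rightarrow> (complex \<Rightarrow> complex) set" where
  "weighted_hardy c = {g \<in> functions_on (ball 0 1). \<exists>u. summable (\<lambda>n. (cmod (u n))\<^sup>2 / c n) \<and>
     (\<forall>z. cmod z < 1 \<longrightarrow> (\<lambda>n. u n * z ^ n) sums g z)}"

lemma weighted_hardyI:
  "\<lbrakk>g \<in> functions_on (ball 0 1); summable (\<lambda>n. (cmod (u n))\<^sup>2 / c n);
    \<And>z. cmod z < 1 \<Longrightarrow> (\<lambda>n. u n * z ^ n) sums g z\<rbrakk> \<Longrightarrow> g \<in> weighted_hardy c"
  by (auto simp: weighted_hardy_def)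

lemma disc_series_holomorphic:
  assumes "\<And>z. cmod z < 1 \<Longrightarrow> (\<lambda>n. u n * z ^ n) sums g z"
  shows "g holomorphic_on ball 0 1"
  using assms by (intro power_series_holomorphic[of 0 1 u]) auto

lemma disc_series_abs_summable:
  fixes u :: "nat \<Rightarrow> complex"
  assumes "\<And>z. cmod z < 1 \<Longrightarrow> (\<lambda>n. u n * z ^ n) sums g z" and z: "cmod z < 1"
  shows "summable (\<lambda>n. cmod (u n * z ^ n))"
proof (rule powser_insidea)
  let ?x = "of_real ((1 + cmod z) / 2) :: complex"
  have x: "cmod ?x = (1 + cmod z) / 2" unfolding norm_of_real by (simp add: abs_of_nonneg)
  show "cmod z < cmod ?x" using z unfolding x by simp
  have "cmod ?x < 1" using z unfolding x by simp
  from assms(1)[OF this] show "summable (\<lambda>n. u n * ?x ^ n)" by (rule sums_summable)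
qed

lemma disc_series_unique:
  assumes u: "\<And>z. cmod z < 1 \<Longrightarrow> (\<lambda>n. u n * z ^ n) sums g z"
    and v: "\<And>z. cmod z < 1 \<Longrightarrow> (\<lambda>n. v n * z ^ n) sums g z"
  shows "u = v"
proof -
  have radius: "fps_conv_radius (Abs_fps w) > 0"
    if "\<And>z. cmod z < 1 \<Longrightarrow> (\<lambda>n. w n * z ^ n) sums g z" for w
  proof -
    have "summable (\<lambda>n. w n * (1/2) ^ n)" using that[of "1/2"] by (intro sums_summable) auto
    then have "conv_radius w \<ge> norm (1/2 :: complex)" by (rule conv_radius_geI)
    then have "conv_radius w > 0" by (rule less_le_trans[rotated]) simp
    then show ?thesis by (simp add: fps_conv_radius_def)
  qed
  have ball: "\<forall>\<^sub>F z in nhds (0::complex). cmod z < 1"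
    using eventually_nhds_in_open[of "ball (0::complex) 1" 0] by simp
  have "Abs_fps u = Abs_fps v"
    by (rule eval_fps_eqD[OF radius[OF u] radius[OF v] eventually_mono[OF ball]])
      (use u v in \<open>auto simp: eval_fps_def sums_iff\<close>)
  then show ?thesis by (metis fps_nth_Abs_fps ext)
qed

lemma disc_series_mult:
  fixes p u :: "nat \<Rightarrow> complex"
  assumes p: "\<And>z. cmod z < 1 \<Longrightarrow> (\<lambda>n. p n * z ^ n) sums \<phi> z"
    and u: "\<And>z. cmod z < 1 \<Longrightarrow> (\<lambda>n. u n * z ^ n) sums g z" and z: "cmod z < 1"
  shows "(\<lambda>n. (\<Sum>i\<le>n. p i * u (n - i)) * z ^ n) sums (\<phi> z * g z)"
proof -
  have "(\<lambda>n. \<Sum>i\<le>n. (p i * z ^ i) * (u (n - i) * z ^ (n - i))) sums (\<phi> z * g z)"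
    using Cauchy_product_sums[OF disc_series_abs_summable[of p, OF p z] disc_series_abs_summable[of u, OF u z]]
      p[OF z] u[OF z] by (simp add: sums_iff)
  also have "(\<lambda>n. \<Sum>i\<le>n. (p i * z ^ i) * (u (n - i) * z ^ (n - i))) = (\<lambda>n. (\<Sum>i\<le>n. p i * u (n - i)) * z ^ n)"
  proof
    fix n
    have "(p i * z ^ i) * (u (n - i) * z ^ (n - i)) = (p i * u (n - i)) * z ^ n" if "i \<in> {..n}" for i
    proof -
      have "z ^ n = z ^ i * z ^ (n - i)" using that by (simp flip: power_add)
      then show ?thesis by simp
    qed
    then show "(\<Sum>i\<le>n. (p i * z ^ i) * (u (n - i) * z ^ (n - i))) = (\<Sum>i\<le>n. p i * u (n - i)) * z ^ n"
      unfolding sum_distrib_right by (rule sum.cong[OF refl])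
  qed
  finally show ?thesis .
qed

lemma weighted_hardy_holomorphic: "g \<in> weighted_hardy c \<Longrightarrow> g holomorphic_on ball 0 1"
  unfolding weighted_hardy_def using disc_series_holomorphic by blast

lemma weighted_hardy_add:
  assumes c: "\<And>n. c n > 0" and f: "f \<in> weighted_hardy c" and g: "g \<in> weighted_hardy c"
  shows "f + g \<in> weighted_hardy c"
proof -
  obtain u where u: "f \<in> functions_on (ball 0 1)" "summable (\<lambda>n. (cmod (u n))\<^sup>2 / c n)"
    "\<And>z. cmod z < 1 \<Longrightarrow> (\<lambda>n. u n * z ^ n) sums f z" using f unfolding weighted_hardy_def by blast
  obtain v where v: "g \<in> functions_on (ball 0 1)" "summable (\<lambda>n. (cmod (v n))\<^sup>2 / c n)"
    "\<And>z. cmod z < 1 \<Longrightarrow> (\<lambda>n. v n * z ^ n) sums g z" using g unfolding weighted_hardy_def by blast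
  show ?thesis
  proof (rule weighted_hardyI[of _ "\<lambda>n. u n + v n"])
    show "f + g \<in> functions_on (ball 0 1)" using u(1) v(1) by (simp add: functions_on_def)
    show "(\<lambda>n. (u n + v n) * z ^ n) sums (f + g) z" if "cmod z < 1" for z
      using sums_add[OF u(3) v(3), OF that that] by (simp add: algebra_simps)
    have sq: "(cmod (x + y))\<^sup>2 \<le> 2 * (cmod x)\<^sup>2 + 2 * (cmod y)\<^sup>2" for x y :: complex
    proof -
      have "(cmod (x + y))\<^sup>2 \<le> (cmod x + cmod y)\<^sup>2" by (intro power_mono norm_triangle_ineq) simp
      also have "\<dots> \<le> 2 * (cmod x)\<^sup>2 + 2 * (cmod y)\<^sup>2"
        using sum_squares_bound[of "cmod x" "cmod y"] by (simp add: power2_sum)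
      finally show ?thesis .
    qed
    show "summable (\<lambda>n. (cmod (u n + v n))\<^sup>2 / c n)"
    proof (rule summable_comparison_test'[where g = "\<lambda>n. 2 * ((cmod (u n))\<^sup>2 / c n) + 2 * ((cmod (v n))\<^sup>2 / c n)" and N = 0])
      show "summable (\<lambda>n. 2 * ((cmod (u n))\<^sup>2 / c n) + 2 * ((cmod (v n))\<^sup>2 / c n))"
        by (intro summable_add summable_mult u v)
      show "norm ((cmod (u n + v n))\<^sup>2 / c n) \<le> 2 * ((cmod (u n))\<^sup>2 / c n) + 2 * ((cmod (v n))\<^sup>2 / c n)" for n
        using divide_right_mono[OF sq[of "u n" "v n"], of "c n"] c[of n] by (simp add: add_divide_distrib)
    qed
  qed
qed

lemma weighted_hardy_cscale:
  assumes f: "f \<in> weighted_hardy c" shows "cscale a f \<in> weighted_hardy c"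
proof -
  obtain u where u: "f \<in> functions_on (ball 0 1)" "summable (\<lambda>n. (cmod (u n))\<^sup>2 / c n)"
    "\<And>z. cmod z < 1 \<Longrightarrow> (\<lambda>n. u n * z ^ n) sums f z" using f unfolding weighted_hardy_def by blast
  show ?thesis
  proof (rule weighted_hardyI[of _ "\<lambda>n. a * u n"])
    show "cscale a f \<in> functions_on (ball 0 1)" using u(1) by (simp add: functions_on_def)
    show "(\<lambda>n. a * u n * z ^ n) sums cscale a f z" if "cmod z < 1" for z
      using sums_mult[OF u(3)[OF that], of a] by (simp add: mult.assoc)
    show "summable (\<lambda>n. (cmod (a * u n))\<^sup>2 / c n)"
      using summable_mult[OF u(2), of "(cmod a)\<^sup>2"] by (simp add: norm_mult power_mult_distrib)
  qed
qed

lemma one_in_weighted_hardy: "restrict0 (ball 0 1) (\<lambda>_. 1) \<in> weighted_hardy c"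
proof (rule weighted_hardyI[of _ "\<lambda>n. if n = 0 then 1 else 0"])
  show "summable (\<lambda>n. (cmod (if n = 0 then 1 else 0))\<^sup>2 / c n)"
    by (rule summable_finite[of "{0}"]) auto
  show "(\<lambda>n. (if n = 0 then 1 else 0) * z ^ n) sums restrict0 (ball 0 1) (\<lambda>_. 1) z" if "cmod z < 1" for z
  proof -
    have "(\<lambda>n. (if n = 0 then 1 else 0) * z ^ n) = (\<lambda>n. if n = 0 then z ^ n else 0)" by auto
    then show ?thesis using that sums_single[of 0 "\<lambda>n. z ^ n"] by (simp add: restrict0_def)
  qed
qed (rule restrict0_in_functions_on)

lemma multiplier_in_weighted_hardy:
  assumes "\<phi> \<in> multiplier_algebra (ball 0 1) (weighted_hardy c)"
  shows "\<phi> \<in> weighted_hardy c"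
proof -
  have "\<phi> * restrict0 (ball 0 1) (\<lambda>_. 1) \<in> weighted_hardy c"
    using assms one_in_weighted_hardy by (auto simp: multiplier_algebra_def)
  moreover have "\<phi> * restrict0 (ball 0 1) (\<lambda>_. 1) = \<phi>"
    using assms by (auto simp: multiplier_algebra_def functions_on_def restrict0_def fun_eq_iff)
  ultimately show ?thesis by simp
qed

text \<open>
  Supermultiplicativity says that \<open>z ^ n\<close> multiplies the space with norm at most
  \<open>1 / sqrt (c n)\<close>, so the series of \<open>\<phi>\<close> converges absolutely in the multiplier norm. In terms
  of coefficients this is Young's inequality for the convolution of a summable with a
  square-summable sequence.
\<close>

lemma weighted_l1_multiplier:
  assumes c: "\<And>n. c n > 0" and sup: "\<And>m n. c m * c n \<le> c (m + n)"
    and p: "summable (\<lambda>n. cmod (p n) / sqrt (c n))"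
    and \<phi>: "\<phi> \<in> functions_on (ball 0 1)" "\<And>z. cmod z < 1 \<Longrightarrow> (\<lambda>n. p n * z ^ n) sums \<phi> z"
  shows "\<phi> \<in> multiplier_algebra (ball 0 1) (weighted_hardy c)"
  unfolding multiplier_algebra_def
proof (intro CollectI conjI ballI \<phi>(1))
  fix g assume "g \<in> weighted_hardy c"
  then obtain u where u: "g \<in> functions_on (ball 0 1)" "summable (\<lambda>n. (cmod (u n))\<^sup>2 / c n)"
    "\<And>z. cmod z < 1 \<Longrightarrow> (\<lambda>n. u n * z ^ n) sums g z" unfolding weighted_hardy_def by blast
  define \<alpha> where "\<alpha> n = cmod (p n) / sqrt (c n)" for n
  define \<beta> where "\<beta> n = cmod (u n) / sqrt (c n)" for n
  define d where "d n = (\<Sum>i\<le>n. p i * u (n - i))" for n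
  have nonneg: "\<alpha> n \<ge> 0" "\<beta> n \<ge> 0" for n using c[of n] by (simp_all add: \<alpha>_def \<beta>_def)
  have \<beta>_sq: "(\<beta> n)\<^sup>2 = (cmod (u n))\<^sup>2 / c n" for n
    using c[of n] by (simp add: \<beta>_def power_divide)
  have "summable \<alpha>" using p by (simp add: \<alpha>_def[abs_def])
  have "summable (\<lambda>n. (\<beta> n)\<^sup>2)" using u(2) by (simp add: \<beta>_sq)
  have "summable (\<lambda>n. \<Sum>i\<le>n. \<alpha> i * (\<beta> (n - i))\<^sup>2)"
    using \<open>summable \<alpha>\<close> \<open>summable (\<lambda>n. (\<beta> n)\<^sup>2)\<close> nonneg
    by (intro sums_summable[OF Cauchy_product_sums]) auto
  then have dom: "summable (\<lambda>n. suminf \<alpha> * (\<Sum>i\<le>n. \<alpha> i * (\<beta> (n - i))\<^sup>2))" by (rule summable_mult)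
  have d_le: "(cmod (d n))\<^sup>2 / c n \<le> suminf \<alpha> * (\<Sum>i\<le>n. \<alpha> i * (\<beta> (n - i))\<^sup>2)" for n
  proof -
    have "cmod (d n) / sqrt (c n) \<le> (\<Sum>i\<le>n. cmod (p i) * cmod (u (n - i))) / sqrt (c n)"
      using c[of n] unfolding d_def norm_mult[symmetric] by (intro divide_right_mono norm_sum) auto
    also have "\<dots> \<le> (\<Sum>i\<le>n. \<alpha> i * \<beta> (n - i))"
      unfolding sum_divide_distrib
    proof (rule sum_mono)
      fix i assume "i \<in> {..n}"
      then have "sqrt (c i) * sqrt (c (n - i)) \<le> sqrt (c n)"
        using sup[of i "n - i"] by (simp flip: real_sqrt_mult)
      then show "cmod (p i) * cmod (u (n - i)) / sqrt (c n) \<le> \<alpha> i * \<beta> (n - i)"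
        using c[of i] c[of "n - i"] unfolding \<alpha>_def \<beta>_def times_divide_times_eq
        by (intro divide_left_mono mult_pos_pos) (auto intro: c)
    qed
    finally have "(cmod (d n) / sqrt (c n))\<^sup>2 \<le> (\<Sum>i\<le>n. \<alpha> i * \<beta> (n - i))\<^sup>2"
      using c[of n] by (intro power_mono) auto
    also have "(\<Sum>i\<le>n. \<alpha> i * \<beta> (n - i)) = (\<Sum>i\<le>n. sqrt (\<alpha> i) * (sqrt (\<alpha> i) * \<beta> (n - i)))"
      using nonneg by (simp flip: mult.assoc)
    also have "\<dots>\<^sup>2 \<le> (\<Sum>i\<le>n. (sqrt (\<alpha> i))\<^sup>2) * (\<Sum>i\<le>n. (sqrt (\<alpha> i) * \<beta> (n - i))\<^sup>2)"
      by (rule Cauchy_Schwarz_ineq_sum)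
    also have "\<dots> = (\<Sum>i\<le>n. \<alpha> i) * (\<Sum>i\<le>n. \<alpha> i * (\<beta> (n - i))\<^sup>2)"
      using nonneg by (simp add: power_mult_distrib)
    also have "\<dots> \<le> suminf \<alpha> * (\<Sum>i\<le>n. \<alpha> i * (\<beta> (n - i))\<^sup>2)"
      using nonneg \<open>summable \<alpha>\<close> by (intro mult_right_mono sum_le_suminf sum_nonneg) auto
    finally show ?thesis using c[of n] by (simp add: power_divide)
  qed
  show "\<phi> * g \<in> weighted_hardy c"
  proof (rule weighted_hardyI[of _ d])
    show "\<phi> * g \<in> functions_on (ball 0 1)" using u(1) by (simp add: functions_on_def)
    show "summable (\<lambda>n. (cmod (d n))\<^sup>2 / c n)"
    proof (rule summable_comparison_test'[OF dom, of 0])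
      show "norm ((cmod (d n))\<^sup>2 / c n) \<le> suminf \<alpha> * (\<Sum>i\<le>n. \<alpha> i * (\<beta> (n - i))\<^sup>2)" for n
        using d_le[of n] c[of n] by simp
    qed
    show "(\<lambda>n. d n * z ^ n) sums (\<phi> * g) z" if "cmod z < 1" for z
      using disc_series_mult[OF \<phi>(2) u(3) that] by (simp add: d_def)
  qed
qed

lemma discrete_Parseval:
  fixes P :: "complex poly"
  assumes N: "degree P < N"
  shows "(\<Sum>j<N. (cmod (poly P (of_real r * cis (2 * pi * real j / real N))))\<^sup>2)
    = real N * (\<Sum>m<N. (cmod (coeff P m))\<^sup>2 * r\<^sup>2 ^ m)"
proof -
  define \<omega> where "\<omega> j = cis (2 * pi * real j / real N)" for j
  define a where "a m = coeff P m * of_real r ^ m" for m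
  have N0: "N > 0" using N by simp
  have poly_eq: "poly P (of_real r * \<omega> j) = (\<Sum>m<N. a m * \<omega> j ^ m)" for j
  proof -
    have "poly P (of_real r * \<omega> j) = (\<Sum>m\<le>degree P. coeff P m * (of_real r * \<omega> j) ^ m)" by (rule poly_altdef)
    also have "\<dots> = (\<Sum>m<N. coeff P m * (of_real r * \<omega> j) ^ m)"
      using N by (intro sum.mono_neutral_left) (auto simp: coeff_eq_0)
    finally show ?thesis by (simp add: a_def power_mult_distrib mult.assoc)
  qed
  have "complex_of_real (\<Sum>j<N. (cmod (poly P (of_real r * \<omega> j)))\<^sup>2)
      = (\<Sum>j<N. (\<Sum>m<N. a m * \<omega> j ^ m) * (\<Sum>l<N. cnj (a l * \<omega> j ^ l)))"
    unfolding of_real_sum complex_norm_square poly_eq by (simp add: cnj_sum)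
  also have "\<dots> = (\<Sum>j<N. \<Sum>m<N. \<Sum>l<N. (a m * cnj (a l)) * (\<omega> j ^ m * cnj (\<omega> j ^ l)))"
    unfolding sum_product by (simp add: mult_ac)
  also have "\<dots> = (\<Sum>m<N. \<Sum>j<N. \<Sum>l<N. (a m * cnj (a l)) * (\<omega> j ^ m * cnj (\<omega> j ^ l)))"
    by (rule sum.swap)
  also have "\<dots> = (\<Sum>m<N. \<Sum>l<N. \<Sum>j<N. (a m * cnj (a l)) * (\<omega> j ^ m * cnj (\<omega> j ^ l)))"
    by (intro sum.cong refl sum.swap)
  also have "\<dots> = (\<Sum>m<N. \<Sum>l<N. if l = m then of_nat N * (a m * cnj (a m)) else 0)"
    unfolding sum_distrib_left[symmetric] \<omega>_def root_of_unity_orthogonality[OF N0]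
    by (intro sum.cong refl) auto
  also have "\<dots> = complex_of_real (real N * (\<Sum>m<N. (cmod (a m))\<^sup>2))"
    by (simp add: complex_norm_square sum_distrib_left del: of_real_power)
  finally have "(\<Sum>j<N. (cmod (poly P (of_real r * \<omega> j)))\<^sup>2) = real N * (\<Sum>m<N. (cmod (a m))\<^sup>2)"
    using of_real_eq_iff by blast
  moreover have "(cmod (a m))\<^sup>2 = (cmod (coeff P m))\<^sup>2 * r\<^sup>2 ^ m" for m
    by (simp add: a_def norm_mult norm_power power_mult_distrib power_mult[symmetric] mult.commute[of m] power_even_abs)
  ultimately show ?thesis unfolding \<omega>_def by simp
qed

lemma truncated_power_series_poly:
  fixes p :: "nat \<Rightarrow> complex"
  defines "P \<equiv> \<lambda>N. (\<Sum>i<N. monom (p i) i)"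
  shows "coeff (P N) i = (if i < N then p i else 0)" and "poly (P N) z = (\<Sum>i<N. p i * z ^ i)"
    and "N > 0 \<Longrightarrow> degree (P N) < N"
proof -
  show c: "coeff (P N) i = (if i < N then p i else 0)" for i by (simp add: P_def coeff_sum)
  show "poly (P N) z = (\<Sum>i<N. p i * z ^ i)" by (simp add: P_def poly_sum poly_monom)
  show "N > 0 \<Longrightarrow> degree (P N) < N" using c by (intro degree_lessI) auto
qed

text \<open>
  On the circle of radius \<open>r < 1\<close>, multiply polynomial truncations of degree below \<open>N\<close> and
  apply the Parseval identity for \<open>2 * N\<close> points, which sees the product without aliasing. The
  truncation of \<open>\<phi>\<close> is bounded there by \<open>M\<close> plus a tail that vanishes as \<open>N\<close> grows, and the
  product has the right coefficients below \<open>N\<close>. Then let \<open>N\<close> tend to infinity and \<open>r\<close> to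
  \<open>1\<close>.
\<close>

lemma bounded_multiplier_l2_bound:
  fixes p u :: "nat \<Rightarrow> complex"
  assumes p: "\<And>z. cmod z < 1 \<Longrightarrow> (\<lambda>n. p n * z ^ n) sums \<phi> z"
    and M: "\<And>z. cmod z < 1 \<Longrightarrow> cmod (\<phi> z) \<le> M"
    and u: "summable (\<lambda>n. (cmod (u n))\<^sup>2)"
  shows "(\<Sum>n<K. (cmod (\<Sum>i\<le>n. p i * u (n - i)))\<^sup>2) \<le> M\<^sup>2 * (\<Sum>n. (cmod (u n))\<^sup>2)"
proof -
  define d where "d n = (\<Sum>i\<le>n. p i * u (n - i))" for n
  define U where "U = (\<Sum>n. (cmod (u n))\<^sup>2)"
  define P where "P q N = (\<Sum>i<N. monom (q i) i)" for q :: "nat \<Rightarrow> complex" and N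
  note P = truncated_power_series_poly[folded P_def]
  have r_bound: "(\<Sum>n<K. (cmod (d n))\<^sup>2 * r\<^sup>2 ^ n) \<le> M\<^sup>2 * U" if r: "0 < r" "r < 1" for r
  proof (rule LIMSEQ_le_const)
    define \<tau> where "\<tau> N = (\<Sum>i. cmod (p (i + N)) * r ^ (i + N))" for N
    have abs: "summable (\<lambda>i. cmod (p i) * r ^ i)"
      using disc_series_abs_summable[of p, OF p, of "of_real r"] r by (simp add: norm_mult norm_power)
    have "\<tau> \<longlonglongrightarrow> 0" unfolding \<tau>_def using suminf_exist_split2[OF abs] .
    then have "(\<lambda>N. (M + \<tau> N)\<^sup>2 * U) \<longlonglongrightarrow> (M + 0)\<^sup>2 * U" by (intro tendsto_intros)
    then show "(\<lambda>N. (M + \<tau> N)\<^sup>2 * U) \<longlonglongrightarrow> M\<^sup>2 * U" by simp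
    show "\<exists>N0. \<forall>N\<ge>N0. (\<Sum>n<K. (cmod (d n))\<^sup>2 * r\<^sup>2 ^ n) \<le> (M + \<tau> N)\<^sup>2 * U"
    proof (intro exI[of _ "Suc K"] allI impI)
      fix N assume N: "Suc K \<le> N"
      define L where "L = 2 * N"
      define \<zeta> where "\<zeta> j = of_real r * cis (2 * pi * real j / real L)" for j
      have \<zeta>: "cmod (\<zeta> j) = r" for j using r by (simp add: \<zeta>_def norm_mult)
      have L: "degree (P p N) < L" "degree (P u N) < L" "degree (P p N * P u N) < L" "L > 0"
        using P(3)[of N p] P(3)[of N u] N degree_mult_le[of "P p N" "P u N"] by (auto simp: L_def)
      have coeff_d: "coeff (P p N * P u N) n = d n" if "n < K" for n
        unfolding coeff_mult d_def using that N by (intro sum.cong) (auto simp: P(1))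
      have P_bound: "cmod (poly (P p N) (\<zeta> j)) \<le> M + \<tau> N" for j
      proof -
        have disc: "cmod (\<zeta> j) < 1" using \<zeta> r by simp
        have "\<phi> (\<zeta> j) = (\<Sum>i. p (i + N) * \<zeta> j ^ (i + N)) + poly (P p N) (\<zeta> j)"
          using suminf_split_initial_segment[of "\<lambda>i. p i * \<zeta> j ^ i" N] p[OF disc] by (simp add: sums_iff P(2))
        then have "poly (P p N) (\<zeta> j) = \<phi> (\<zeta> j) - (\<Sum>i. p (i + N) * \<zeta> j ^ (i + N))" by simp
        also have "cmod \<dots> \<le> cmod (\<phi> (\<zeta> j)) + cmod (\<Sum>i. p (i + N) * \<zeta> j ^ (i + N))" by (rule norm_triangle_ineq4)
        also have "\<dots> \<le> M + \<tau> N"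
          unfolding \<tau>_def using abs \<zeta>
          by (intro add_mono M disc norm_suminf_le summable_ignore_initial_segment) (auto simp: norm_mult norm_power)
        finally show ?thesis .
      qed
      have "L * (\<Sum>n<K. (cmod (d n))\<^sup>2 * r\<^sup>2 ^ n) = L * (\<Sum>n<K. (cmod (coeff (P p N * P u N) n))\<^sup>2 * r\<^sup>2 ^ n)"
        by (simp add: coeff_d)
      also have "\<dots> \<le> L * (\<Sum>n<L. (cmod (coeff (P p N * P u N) n))\<^sup>2 * r\<^sup>2 ^ n)"
        using N by (intro mult_left_mono sum_mono2) (auto simp: L_def)
      also have "\<dots> = (\<Sum>j<L. (cmod (poly (P p N) (\<zeta> j)))\<^sup>2 * (cmod (poly (P u N) (\<zeta> j)))\<^sup>2)"
        unfolding discrete_Parseval[OF L(3), symmetric] \<zeta>_def by (simp add: norm_mult power_mult_distrib)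
      also have "\<dots> \<le> (\<Sum>j<L. (M + \<tau> N)\<^sup>2 * (cmod (poly (P u N) (\<zeta> j)))\<^sup>2)"
        using P_bound by (intro sum_mono mult_right_mono power_mono) auto
      also have "\<dots> = (M + \<tau> N)\<^sup>2 * (L * (\<Sum>m<L. (cmod (coeff (P u N) m))\<^sup>2 * r\<^sup>2 ^ m))"
        unfolding discrete_Parseval[OF L(2), symmetric] \<zeta>_def by (simp add: sum_distrib_left)
      finally have chain: "L * (\<Sum>n<K. (cmod (d n))\<^sup>2 * r\<^sup>2 ^ n)
        \<le> (M + \<tau> N)\<^sup>2 * (L * (\<Sum>m<L. (cmod (coeff (P u N) m))\<^sup>2 * r\<^sup>2 ^ m))" .
      have "(\<Sum>m<L. (cmod (coeff (P u N) m))\<^sup>2 * r\<^sup>2 ^ m) \<le> (\<Sum>m<L. (cmod (u m))\<^sup>2)"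
      proof (rule sum_mono)
        fix m
        have "(cmod (coeff (P u N) m))\<^sup>2 * r\<^sup>2 ^ m \<le> (cmod (u m))\<^sup>2 * 1"
          using r by (intro mult_mono power_le_one) (auto simp: P(1) power_le_one)
        then show "(cmod (coeff (P u N) m))\<^sup>2 * r\<^sup>2 ^ m \<le> (cmod (u m))\<^sup>2" by simp
      qed
      also have "(\<Sum>m<L. (cmod (u m))\<^sup>2) \<le> U" unfolding U_def using u by (intro sum_le_suminf) auto
      finally have "(M + \<tau> N)\<^sup>2 * (L * (\<Sum>m<L. (cmod (coeff (P u N) m))\<^sup>2 * r\<^sup>2 ^ m))
          \<le> (M + \<tau> N)\<^sup>2 * (L * U)" by (intro mult_left_mono) auto
      with chain have "L * (\<Sum>n<K. (cmod (d n))\<^sup>2 * r\<^sup>2 ^ n) \<le> L * ((M + \<tau> N)\<^sup>2 * U)"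
        by (simp only: mult.left_commute)
      then show "(\<Sum>n<K. (cmod (d n))\<^sup>2 * r\<^sup>2 ^ n) \<le> (M + \<tau> N)\<^sup>2 * U" using L(4) by simp
    qed
  qed
  have "(\<Sum>n<K. (cmod (d n))\<^sup>2) \<le> M\<^sup>2 * U"
  proof (rule LIMSEQ_le_const2)
    define \<rho> where "\<rho> j = 1 - inverse (real (Suc j))" for j
    have "\<rho> \<longlonglongrightarrow> 1 - 0"
      unfolding \<rho>_def by (intro tendsto_diff tendsto_const LIMSEQ_inverse_real_of_nat)
    then have "(\<lambda>j. \<Sum>n<K. (cmod (d n))\<^sup>2 * (\<rho> j)\<^sup>2 ^ n) \<longlonglongrightarrow> (\<Sum>n<K. (cmod (d n))\<^sup>2 * (1 - 0)\<^sup>2 ^ n)"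
      by (intro tendsto_sum tendsto_mult tendsto_power tendsto_const)
    then show "(\<lambda>j. \<Sum>n<K. (cmod (d n))\<^sup>2 * (\<rho> j)\<^sup>2 ^ n) \<longlonglongrightarrow> (\<Sum>n<K. (cmod (d n))\<^sup>2)"
      by simp
    have "0 < \<rho> j" "\<rho> j < 1" if "1 \<le> j" for j
      using that by (auto simp: \<rho>_def inverse_eq_divide)
    then show "\<exists>N. \<forall>j\<ge>N. (\<Sum>n<K. (cmod (d n))\<^sup>2 * (\<rho> j)\<^sup>2 ^ n) \<le> M\<^sup>2 * U"
      using r_bound by (intro exI[of _ 1]) auto
  qed
  then show ?thesis by (simp add: d_def U_def)
qed

text \<open>
  With both bounds on \<open>c\<close> the space is the classical Hardy space with an equivalent norm.
\<close>

lemma H_infty_subset_multipliers: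
  assumes c: "\<And>n. c n \<le> 1" "\<delta> > 0" "\<And>n. \<delta> \<le> c n"
  shows "H_infty \<subseteq> multiplier_algebra (ball 0 1) (weighted_hardy c)"
proof
  fix \<phi> assume \<phi>: "\<phi> \<in> H_infty"
  obtain M where M: "\<And>z. cmod z < 1 \<Longrightarrow> cmod (\<phi> z) \<le> M" using H_infty_bounded[OF \<phi>] by blast
  have \<phi>_on: "\<phi> \<in> functions_on (ball 0 1)" and hol: "\<phi> holomorphic_on ball 0 1"
    using \<phi> by (auto simp: H_infty_def)
  define p where "p n = (deriv ^^ n) \<phi> 0 / fact n" for n
  have p: "(\<lambda>n. p n * z ^ n) sums \<phi> z" if "cmod z < 1" for z
    using holomorphic_power_series[OF hol, of z] that by (simp add: p_def)
  have c_pos: "c n > 0" for n using c(2) c(3)[of n] by simp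
  show "\<phi> \<in> multiplier_algebra (ball 0 1) (weighted_hardy c)"
    unfolding multiplier_algebra_def
  proof (intro CollectI conjI ballI \<phi>_on)
    fix g assume "g \<in> weighted_hardy c"
    then obtain u where u: "g \<in> functions_on (ball 0 1)" "summable (\<lambda>n. (cmod (u n))\<^sup>2 / c n)"
      "\<And>z. cmod z < 1 \<Longrightarrow> (\<lambda>n. u n * z ^ n) sums g z" unfolding weighted_hardy_def by blast
    define d where "d n = (\<Sum>i\<le>n. p i * u (n - i))" for n
    have u2: "summable (\<lambda>n. (cmod (u n))\<^sup>2)"
    proof (rule summable_comparison_test'[OF u(2), of 0])
      show "norm ((cmod (u n))\<^sup>2) \<le> (cmod (u n))\<^sup>2 / c n" for n
        using c(1)[of n] c_pos[of n] by (simp add: le_divide_eq mult_left_le)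
    qed
    have "summable (\<lambda>n. (cmod (d n))\<^sup>2)"
      unfolding d_def using bounded_multiplier_l2_bound[OF p M u2] by (intro summableI_nonneg_bounded) auto
    then have dom: "summable (\<lambda>n. 1 / \<delta> * (cmod (d n))\<^sup>2)" by (rule summable_mult)
    show "\<phi> * g \<in> weighted_hardy c"
    proof (rule weighted_hardyI[of _ d])
      show "\<phi> * g \<in> functions_on (ball 0 1)" using u(1) by (simp add: functions_on_def)
      show "summable (\<lambda>n. (cmod (d n))\<^sup>2 / c n)"
      proof (rule summable_comparison_test'[OF dom, of 0])
        show "norm ((cmod (d n))\<^sup>2 / c n) \<le> 1 / \<delta> * (cmod (d n))\<^sup>2" for n
          using c(2) c(3)[of n] c_pos[of n] by (simp add: frac_le)
      qed
      show "(\<lambda>n. d n * z ^ n) sums (\<phi> * g) z" if "cmod z < 1" for z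
        using disc_series_mult[OF p u(3) that] by (simp add: d_def)
    qed
  qed
qed

text \<open>
  The witness is the gap series \<open>\<Sum>j. (1/2) ^ j * z ^ (\<nu> j)\<close>, where \<open>\<nu>\<close> increases so fast that
  \<open>c (\<nu> j) < (1/4) ^ j\<close>: its coefficients are summable, but none of the terms
  \<open>(1/4) ^ j / c (\<nu> j)\<close> of its weighted norm is less than \<open>1\<close>.
\<close>

lemma H_infty_not_subset_weighted_hardy:
  assumes c: "\<And>n. c n > 0" and nb: "\<And>\<delta>. \<delta> > 0 \<Longrightarrow> \<exists>n. c n < \<delta>"
  shows "\<exists>\<phi>\<in>H_infty. \<phi> \<notin> weighted_hardy c"
proof -
  have small: "\<exists>n>N. c n < \<epsilon>" if "\<epsilon> > 0" for \<epsilon> N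
  proof -
    define \<delta> where "\<delta> = Min (insert \<epsilon> (c ` {..N}))"
    have "\<delta> > 0" unfolding \<delta>_def using that c by (subst Min_gr_iff) auto
    then obtain n where n: "c n < \<delta>" using nb by blast
    have "\<delta> \<le> \<epsilon>" unfolding \<delta>_def by (intro Min_le) auto
    moreover have "\<delta> \<le> c m" if "m \<le> N" for m unfolding \<delta>_def using that by (intro Min_le) auto
    ultimately show ?thesis using n by (meson leD less_le_trans not_le_imp_less)
  qed
  have "\<exists>\<nu>. \<forall>j. c (\<nu> j) < (1/4) ^ j \<and> \<nu> j < \<nu> (Suc j)"
  proof (rule dependent_nat_choice)
    show "\<exists>n. c n < (1/4) ^ 0" using small[of "(1/4) ^ 0" 0] by auto
    show "\<exists>m. c m < (1/4) ^ Suc j \<and> n < m" for n j using small[of "(1/4) ^ Suc j" n] by auto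
  qed
  then obtain \<nu> where \<nu>: "\<And>j. c (\<nu> j) < (1/4) ^ j" "\<And>j. \<nu> j < \<nu> (Suc j)" by blast
  have mono: "strict_mono \<nu>" using \<nu>(2) by (simp add: strict_mono_Suc_iff)
  then have inj: "inj \<nu>" by (rule strict_mono_imp_inj_on)
  define p :: "nat \<Rightarrow> real" where "p n = (if n \<in> range \<nu> then (1/2) ^ (inv \<nu> n) else 0)" for n
  have p_\<nu>: "p (\<nu> j) = (1/2) ^ j" for j by (simp add: p_def inv_f_f[OF inj])
  have p0: "p n \<ge> 0" for n by (simp add: p_def)
  have "summable (\<lambda>j. p (\<nu> j))" by (simp add: p_\<nu>)
  then have sp: "summable p" by (subst (asm) summable_mono_reindex[OF mono]) (auto simp: p_def)
  define \<phi> where "\<phi> z = (\<Sum>n. of_real (p n) * z ^ n)" for z :: complex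
  have term_le: "cmod (of_real (p n) * z ^ n) \<le> p n" if "cmod z < 1" for n z
    using that p0[of n] by (simp add: norm_mult norm_power mult_left_le power_le_one)
  have \<phi>: "(\<lambda>n. of_real (p n) * z ^ n) sums \<phi> z" if "cmod z < 1" for z
    unfolding \<phi>_def using term_le[OF that]
    by (intro summable_sums summable_comparison_test'[OF sp, of 0]) auto
  have "cmod (\<phi> z) \<le> suminf p" if "cmod z < 1" for z
    unfolding \<phi>_def using term_le[OF that] sp by (intro norm_suminf_le) auto
  then have "restrict0 (ball 0 1) \<phi> \<in> H_infty"
    by (intro H_infty_restrict0I disc_series_holomorphic[OF \<phi>])
  moreover have "restrict0 (ball 0 1) \<phi> \<notin> weighted_hardy c"
  proof
    assume "restrict0 (ball 0 1) \<phi> \<in> weighted_hardy c"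
    then obtain u where u: "summable (\<lambda>n. (cmod (u n))\<^sup>2 / c n)"
      "\<And>z. cmod z < 1 \<Longrightarrow> (\<lambda>n. u n * z ^ n) sums restrict0 (ball 0 1) \<phi> z" unfolding weighted_hardy_def by blast
    have "u = (\<lambda>n. of_real (p n))"
      by (rule disc_series_unique[of _ "restrict0 (ball 0 1) \<phi>"]) (use u(2) \<phi> in \<open>auto simp: restrict0_def\<close>)
    then have "(\<lambda>n. (p n)\<^sup>2 / c n) \<longlonglongrightarrow> 0" using summable_LIMSEQ_zero[OF u(1)] by simp
    then have "(\<lambda>j. (p (\<nu> j))\<^sup>2 / c (\<nu> j)) \<longlonglongrightarrow> 0"
      using LIMSEQ_subseq_LIMSEQ[OF _ mono] by (auto simp: comp_def)
    moreover have "1 \<le> (p (\<nu> j))\<^sup>2 / c (\<nu> j)" for j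
    proof -
      have "(p (\<nu> j))\<^sup>2 = (1/4) ^ j"
        unfolding p_\<nu> power2_eq_square power_mult_distrib[symmetric] by simp
      then show ?thesis using \<nu>(1)[of j] c[of "\<nu> j"] by (simp only: le_divide_eq_1_pos less_imp_le)
    qed
    ultimately have "1 \<le> (0::real)" by (intro LIMSEQ_le_const[where X = "\<lambda>j. (p (\<nu> j))\<^sup>2 / c (\<nu> j)"]) auto
    then show False by simp
  qed
  ultimately show ?thesis by blast
qed

lemma (in rkhs_on_disc) restrict0_pullback_in_weighted_hardy:
  assumes "F \<in> H" and G: "\<And>z. cmod z < 1 \<Longrightarrow> G z = F (\<gamma> z)"
  shows "restrict0 (ball 0 1) G \<in> weighted_hardy c"
proof -
  obtain u where u: "summable (\<lambda>n. (cmod (u n))\<^sup>2 / c n)"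
    "\<And>z. cmod z < 1 \<Longrightarrow> (\<lambda>n. u n * z ^ n) sums F (\<gamma> z)"
    using pullback_power_series[OF assms(1)] by blast
  show ?thesis
    by (rule weighted_hardyI[OF restrict0_in_functions_on u(1)]) (use u(2) G in \<open>simp add: restrict0_def\<close>)
qed

lemma (in rkhs_on_disc) weighted_hardy_extends:
  assumes "g \<in> weighted_hardy c"
  shows "\<exists>F\<in>closed_span H ip (kernel_fun X k ` \<gamma> ` ball 0 1). \<forall>z. cmod z < 1 \<longrightarrow> F (\<gamma> z) = g z"
proof -
  obtain u where u: "summable (\<lambda>n. (cmod (u n))\<^sup>2 / c n)"
    "\<And>z. cmod z < 1 \<Longrightarrow> (\<lambda>n. u n * z ^ n) sums g z"
    using assms unfolding weighted_hardy_def by blast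
  obtain F where "F \<in> closed_span H ip (kernel_fun X k ` \<gamma> ` ball 0 1)"
    "\<And>z. cmod z < 1 \<Longrightarrow> (\<lambda>n. u n * z ^ n) sums F (\<gamma> z)"
    using power_series_in_closed_span[OF u(1)] by blast
  then show ?thesis using u(2) sums_unique2 by blast
qed

lemma (in rkhs_on_disc) weighted_hardy_multiplier_bounded:
  assumes \<phi>: "\<phi> \<in> multiplier_algebra (ball 0 1) (weighted_hardy c)"
    and \<gamma>': "\<And>z. cmod z < 1 \<Longrightarrow> \<gamma>' (\<gamma> z) = z"
  shows "bounded (\<phi> ` ball 0 1)"
proof -
  have "bounded ((\<phi> \<circ> \<gamma>') ` \<gamma> ` ball 0 1)"
  proof (rule multiplier_bounded)
    show "\<gamma> ` ball 0 1 \<subseteq> X" using disc_in by auto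
  next
    fix y assume "y \<in> \<gamma> ` ball 0 1"
    then obtain z where z: "cmod z < 1" "y = \<gamma> z" by auto
    have s: "(\<lambda>n. of_real (c n * (cmod z)\<^sup>2 ^ n)) sums k (\<gamma> z) (\<gamma> z)"
      using kernel_sums[OF z(1) z(1)]
      by (simp add: of_real_power[symmetric] complex_norm_square[symmetric] del: of_real_power)
    then have "(\<lambda>n. c n * (cmod z)\<^sup>2 ^ n) sums Re (k (\<gamma> z) (\<gamma> z))" by (simp add: sums_complex_iff)
    then have "(\<Sum>n\<in>{0}. c n * (cmod z)\<^sup>2 ^ n) \<le> Re (k (\<gamma> z) (\<gamma> z))"
      using sum_le_suminf[of "\<lambda>n. c n * (cmod z)\<^sup>2 ^ n" "{0}"] c_pos by (simp add: sums_iff less_imp_le)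
    then show "k y y \<noteq> 0" using c_pos[of 0] z(2) by auto
  next
    fix F assume F: "F \<in> H"
    have "restrict0 (ball 0 1) (F \<circ> \<gamma>) \<in> weighted_hardy c"
      by (rule restrict0_pullback_in_weighted_hardy[OF F]) simp
    then have "\<phi> * restrict0 (ball 0 1) (F \<circ> \<gamma>) \<in> weighted_hardy c"
      using \<phi> by (simp add: multiplier_algebra_def)
    from weighted_hardy_extends[OF this] obtain G where
      "G \<in> closed_span H ip (kernel_fun X k ` \<gamma> ` ball 0 1)"
      "\<And>z. cmod z < 1 \<Longrightarrow> G (\<gamma> z) = (\<phi> * restrict0 (ball 0 1) (F \<circ> \<gamma>)) z" by blast
    moreover from this have "G \<in> H" by (simp add: closed_span_def)
    ultimately show "\<exists>G\<in>H. \<forall>y\<in>\<gamma> ` ball 0 1. G y = (\<phi> \<circ> \<gamma>') y * F y"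
      by (intro bexI[of _ G]) (auto simp: restrict0_def \<gamma>')
  qed
  moreover have "(\<phi> \<circ> \<gamma>') ` \<gamma> ` ball 0 1 = \<phi> ` ball 0 1"
    unfolding image_image by (rule image_cong) (auto simp: \<gamma>')
  ultimately show ?thesis by simp
qed

text \<open>
  If \<open>c\<close> is bounded below, the multiplier algebra is equal to \<open>H_infty\<close>. Conversely, an isomorphism
  forces \<open>H_infty\<close> into the multiplier algebra, hence into the space itself, which fails if \<open>c\<close> is
  not bounded below. The lower bound \<open>subexp\<close> serves to show that the coordinate function has
  spectral radius at most \<open>1\<close> as a multiplier.
\<close>

lemma weighted_hardy_multipliers_iso_iff:
  assumes c: "\<And>n. c n > 0" "\<And>n. c n \<le> 1" and sup: "\<And>m n. c m * c n \<le> c (m + n)"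
    and subexp: "\<And>r. 0 < r \<Longrightarrow> r < 1 \<Longrightarrow> \<exists>\<delta>>0. \<forall>n. \<delta> * r ^ n \<le> c n"
    and bdd: "\<And>\<phi>. \<phi> \<in> multiplier_algebra (ball 0 1) (weighted_hardy c) \<Longrightarrow> bounded (\<phi> ` ball 0 1)"
  shows "algebra_isomorphic (multiplier_algebra (ball 0 1) (weighted_hardy c)) H_infty
    \<longleftrightarrow> (\<exists>\<delta>>0. \<forall>n. \<delta> \<le> c n)"
proof
  let ?A = "multiplier_algebra (ball 0 1) (weighted_hardy c)"
  assume "\<exists>\<delta>>0. \<forall>n. \<delta> \<le> c n"
  then have "H_infty \<subseteq> ?A" using H_infty_subset_multipliers[of c] c(2) by blast
  moreover have "?A \<subseteq> H_infty"
  proof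
    fix \<phi> assume \<phi>: "\<phi> \<in> ?A"
    then have "\<phi> \<in> functions_on (ball 0 1)" by (simp add: multiplier_algebra_def)
    then show "\<phi> \<in> H_infty"
      using bdd[OF \<phi>] weighted_hardy_holomorphic[OF multiplier_in_weighted_hardy[OF \<phi>]]
      by (simp add: H_infty_def)
  qed
  ultimately have "?A = H_infty" by blast
  then show "algebra_isomorphic ?A H_infty" unfolding algebra_isomorphic_def by (auto intro!: exI[of _ id])
next
  let ?A = "multiplier_algebra (ball 0 1) (weighted_hardy c)"
  assume iso: "algebra_isomorphic ?A H_infty"
  have l1: "\<phi> \<in> ?A" if "summable (\<lambda>n. cmod (p n) / sqrt (c n))" "\<phi> \<in> functions_on (ball 0 1)"
    "\<And>z. cmod z < 1 \<Longrightarrow> (\<lambda>n. p n * z ^ n) sums \<phi> z" for \<phi> p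
    using that by (rule weighted_l1_multiplier[OF c(1) sup])
  have "H_infty \<subseteq> ?A"
  proof (rule H_infty_subset_of_isomorphic_algebra[OF _ _ _ _ _ _ _ _ iso])
    show "?A \<subseteq> functions_on (ball 0 1)" by (auto simp: multiplier_algebra_def)
    show "\<phi> holomorphic_on ball 0 1" if "\<phi> \<in> ?A" for \<phi>
      by (rule weighted_hardy_holomorphic[OF multiplier_in_weighted_hardy[OF that]])
    show "\<phi> + \<psi> \<in> ?A" if "\<phi> \<in> ?A" "\<psi> \<in> ?A" for \<phi> \<psi>
      using that weighted_hardy_add[OF c(1)]
      by (auto simp: multiplier_algebra_def functions_on_def distrib_right)
    show "\<phi> * \<psi> \<in> ?A" if "\<phi> \<in> ?A" "\<psi> \<in> ?A" for \<phi> \<psi>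
      using that by (auto simp: multiplier_algebra_def functions_on_def mult.assoc)
    show "cscale a \<phi> \<in> ?A" if "\<phi> \<in> ?A" for a \<phi>
    proof -
      have "cscale a \<phi> * g = cscale a (\<phi> * g)" for g by (auto simp: fun_eq_iff)
      then show ?thesis using that weighted_hardy_cscale[of _ c a]
        by (auto simp: multiplier_algebra_def functions_on_def)
    qed
    have monomial: "restrict0 (ball 0 1) (\<lambda>z. z ^ k) \<in> ?A" for k
    proof (rule l1[of "\<lambda>n. if n = k then 1 else 0"])
      show "summable (\<lambda>n. cmod (if n = k then 1 else 0) / sqrt (c n))"
        by (rule summable_finite[of "{k}"]) auto
      have "(\<lambda>n. (if n = k then 1 else 0) * z ^ n) = (\<lambda>n. if n = k then z ^ n else 0)" for z :: complex by auto
      then show "(\<lambda>n. (if n = k then 1 else 0) * z ^ n) sums restrict0 (ball 0 1) (\<lambda>z. z ^ k) z" if "cmod z < 1" for z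
        using that sums_single[of k "\<lambda>n. z ^ n"] by (simp add: restrict0_def)
    qed (rule restrict0_in_functions_on)
    show "restrict0 (ball 0 1) (\<lambda>_. 1) \<in> ?A" using monomial[of 0] by simp
    show "restrict0 (ball 0 1) (\<lambda>z. z) \<in> ?A" using monomial[of 1] by simp
    show "restrict0 (ball 0 1) (\<lambda>z. 1 / (z - \<alpha>)) \<in> ?A" if \<alpha>: "1 < cmod \<alpha>" for \<alpha>
    proof (rule l1[of "\<lambda>n. - (1 / \<alpha>) * (1 / \<alpha>) ^ n"])
      \<comment> \<open>The geometric series of \<open>1 / (z - \<alpha>)\<close> has coefficients of size \<open>(s\<^sup>2) ^ (n + 1)\<close>, and
         comparing \<open>c n\<close> with \<open>(s\<^sup>2) ^ n\<close> costs a factor \<open>s ^ n\<close> of them.\<close>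
      define s where "s = sqrt (1 / cmod \<alpha>)"
      have "0 < 1 / cmod \<alpha>" "1 / cmod \<alpha> < 1" using \<alpha> by (auto simp: divide_less_eq)
      then have s: "0 < s" "s < 1" "s\<^sup>2 = 1 / cmod \<alpha>" by (auto simp: s_def)
      have "0 < s\<^sup>2" "s\<^sup>2 < 1" using s(1,2) by (simp_all add: power_less_one_iff)
      then obtain \<delta> where \<delta>: "\<delta> > 0" "\<And>n. \<delta> * (s\<^sup>2) ^ n \<le> c n"
        using subexp[of "s\<^sup>2"] by blast
      have geo: "summable (\<lambda>n. s\<^sup>2 / sqrt \<delta> * s ^ n)" using s by (intro summable_mult summable_geometric) auto
      show "summable (\<lambda>n. cmod (- (1 / \<alpha>) * (1 / \<alpha>) ^ n) / sqrt (c n))"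
      proof (rule summable_comparison_test'[OF geo, of 0])
        fix n
        have "sqrt \<delta> * s ^ n = sqrt (\<delta> * (s\<^sup>2) ^ n)"
          using s(1) by (simp add: real_sqrt_mult real_sqrt_power)
        also have "\<dots> \<le> sqrt (c n)" using \<delta>(2) by (rule real_sqrt_le_mono)
        finally have le: "sqrt \<delta> * s ^ n \<le> sqrt (c n)" .
        have "cmod (- (1 / \<alpha>) * (1 / \<alpha>) ^ n) / sqrt (c n) = (s\<^sup>2 * (s\<^sup>2) ^ n) / sqrt (c n)"
          unfolding s(3) by (simp add: norm_mult norm_divide norm_power)
        also have "\<dots> \<le> (s\<^sup>2 * (s\<^sup>2) ^ n) / (sqrt \<delta> * s ^ n)"
          using le s(1) \<delta>(1) c(1)[of n] by (intro divide_left_mono mult_pos_pos) auto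
        also have "\<dots> = s\<^sup>2 / sqrt \<delta> * s ^ n"
          using s(1) by (simp add: power2_eq_square power_mult_distrib)
        finally show "norm (cmod (- (1 / \<alpha>) * (1 / \<alpha>) ^ n) / sqrt (c n)) \<le> s\<^sup>2 / sqrt \<delta> * s ^ n"
          using c(1)[of n] by simp
      qed
      fix z :: complex assume z: "cmod z < 1"
      then have "cmod z < cmod \<alpha>" using \<alpha> by simp
      then have "cmod (z / \<alpha>) < 1" using \<alpha> by (simp add: norm_divide divide_less_eq)
      then have "(\<lambda>n. - (1 / \<alpha>) * (z / \<alpha>) ^ n) sums (- (1 / \<alpha>) * (1 / (1 - z / \<alpha>)))"
        by (intro sums_mult geometric_sums)
      also have "- (1 / \<alpha>) * (1 / (1 - z / \<alpha>)) = 1 / (z - \<alpha>)"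
      proof -
        have "\<alpha> \<noteq> 0" "z \<noteq> \<alpha>" using \<alpha> z by auto
        then show ?thesis by (simp add: field_simps)
      qed
      finally show "(\<lambda>n. - (1 / \<alpha>) * (1 / \<alpha>) ^ n * z ^ n) sums restrict0 (ball 0 1) (\<lambda>z. 1 / (z - \<alpha>)) z"
        using z by (simp add: restrict0_def power_divide)
    qed (rule restrict0_in_functions_on)
  qed
  then have "H_infty \<subseteq> weighted_hardy c" using multiplier_in_weighted_hardy by blast
  then show "\<exists>\<delta>>0. \<forall>n. \<delta> \<le> c n"
    using H_infty_not_subset_weighted_hardy[of c] c(1) by (meson not_le subsetD)
qed

section \<open>Multipliers on the embedded disc\<close>

theorem corollary7p6:
  fixes H :: "((nat \<Rightarrow> complex) \<Rightarrow> complex) set"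
    and ip :: "((nat \<Rightarrow> complex) \<Rightarrow> complex) \<Rightarrow> ((nat \<Rightarrow> complex) \<Rightarrow> complex) \<Rightarrow> complex"
    and b :: "nat \<Rightarrow> complex"
    and f :: "complex \<Rightarrow> nat \<Rightarrow> complex"
    and V :: "(nat \<Rightarrow> complex) set"
  assumes drury_arveson: "is_drury_arveson H ip"
    and b_ell2: "b \<in> ell2"
    and b_norm: "ell2_norm b = 1"
    and b_first: "b 0 \<noteq> 0"
    and f_eq: "f = (\<lambda>z n. b n * z ^ (n + 1))"
    and V_eq: "V = f ` ball 0 1"
  shows "algebra_isomorphic (multiplier_algebra V (da_subspace H ip V)) H_infty
    \<longleftrightarrow> summable (\<lambda>n. real (n + 1) * (cmod (b n))\<^sup>2)"
proof -
  define a where "a n = (cmod (b n))\<^sup>2" for n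
  define c where "c = renewal a"
  have a: "a n \<ge> 0" for n by (simp add: a_def)
  have a0: "a 0 > 0" using b_first by (simp add: a_def)
  have a_sums: "a sums 1"
    using b_ell2 b_norm by (simp add: ell2_def ell2_norm_def a_def[abs_def] sums_iff)
  then have a_sum: "summable a" "suminf a \<le> 1" by (auto simp: sums_iff)
  have c_bounds: "0 < c n" "c n \<le> 1" for n unfolding c_def using renewal_bounds[OF a a0 a_sum] by auto
  \<comment> \<open>The step of length \<open>n + 1\<close> has probability \<open>a n\<close>, because coordinate \<open>n\<close> of \<open>f z\<close> is a
     multiple of \<open>z ^ (n + 1)\<close>.\<close>
  have f_norm: "(\<lambda>n. (cmod (f z n))\<^sup>2) = (\<lambda>n. a n * (cmod z)\<^sup>2 ^ Suc n)" for z
    unfolding f_eq a_def by (simp add: norm_mult norm_power power_mult_distrib power_mult[symmetric] mult.commute[of 2] flip: power2_eq_square)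
  have f_ball: "f z \<in> ell2_ball" if z: "cmod z < 1" for z
  proof -
    define t where "t = (cmod z)\<^sup>2"
    have t: "0 \<le> t" "t < 1" using z by (auto simp: t_def power_less_one_iff)
    have le: "a n * t ^ Suc n \<le> a n * t" for n
      using a[of n] t power_le_one[of t n] by (intro mult_left_mono) (auto simp: mult_left_le)
    have at: "summable (\<lambda>n. a n * t)" by (rule summable_mult2[OF a_sum(1)])
    have s: "summable (\<lambda>n. a n * t ^ Suc n)"
    proof (rule summable_comparison_test'[OF at, of 0])
      show "norm (a n * t ^ Suc n) \<le> a n * t" for n using le[of n] a[of n] t(1) by simp
    qed
    have "(\<Sum>n. a n * t ^ Suc n) \<le> (\<Sum>n. a n * t)" by (rule suminf_le[OF le s at])
    also have "\<dots> = suminf a * t" by (rule suminf_mult2[OF a_sum(1), symmetric])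
    also have "\<dots> = t" using a_sums by (simp add: sums_iff)
    finally show ?thesis using s t(2) unfolding ell2_ball_def ell2_def ell2_norm_def mem_Collect_eq f_norm t_def[symmetric]
      by simp
  qed
  have kernel: "(\<lambda>n. of_real (c n) * (z * cnj w) ^ n) sums da_kernel (f z) (f w)"
    if z: "cmod z < 1" and w: "cmod w < 1" for z w
  proof -
    have "cmod (z * cnj w) < 1" using z w mult_strict_mono'[of "cmod z" 1 "cmod w" 1] by (simp add: norm_mult)
    from renewal_power_series[OF a a0 a_sum this] show ?thesis
      unfolding c_def da_kernel_def ell2_inner_def f_eq a_def complex_norm_square
      by (simp add: power_mult_distrib mult_ac)
  qed
  interpret rkhs_on_disc ell2_ball H ip da_kernel f c
    using drury_arveson f_ball kernel c_bounds
    unfolding is_drury_arveson_def rkhs_on_disc_def rkhs_on_disc_axioms_def by blast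
  \<comment> \<open>The first coordinate recovers \<open>z\<close> from \<open>f z\<close>.\<close>
  define f' where "f' x = x 0 / b 0" for x :: "nat \<Rightarrow> complex"
  have f'_f: "f' (f z) = z" for z using b_first by (simp add: f'_def f_eq)
  let ?W = "weighted_hardy c" and ?D = "ball (0::complex) 1" and ?S = "da_subspace H ip V"
  have C: "closed_span H ip (kernel_fun ell2_ball da_kernel ` V) \<subseteq> H" by (auto simp: closed_span_def)
  have W_on: "?W \<subseteq> functions_on ?D" by (auto simp: weighted_hardy_def)
  have S_on: "?S \<subseteq> functions_on V" by (auto simp: da_subspace_def restrict0_in_functions_on)
  have V_D: "y \<in> V \<Longrightarrow> f' y \<in> ?D" "y \<in> V \<Longrightarrow> f (f' y) = y" for y
    using f'_f by (auto simp: V_eq)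
  have D_V: "z \<in> ?D \<Longrightarrow> f z \<in> V" for z by (auto simp: V_eq)
  have S_W: "restrict0 ?D (g \<circ> f) \<in> ?W" if g: "g \<in> ?S" for g
  proof -
    obtain F where F: "F \<in> H" "g = restrict0 V F" using g C by (auto simp: da_subspace_def)
    show ?thesis
      by (rule restrict0_pullback_in_weighted_hardy[OF F(1)]) (use D_V in \<open>auto simp: F(2) restrict0_def\<close>)
  qed
  have W_S: "restrict0 V (g \<circ> f') \<in> ?S" if g: "g \<in> ?W" for g
  proof -
    obtain F where F: "F \<in> closed_span H ip (kernel_fun ell2_ball da_kernel ` V)"
      "\<And>z. cmod z < 1 \<Longrightarrow> F (f z) = g z"
      using weighted_hardy_extends[OF g] unfolding V_eq by blast
    have "restrict0 V (g \<circ> f') = restrict0 V F"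
      using F(2) f'_f by (auto simp: restrict0_def fun_eq_iff V_eq)
    then show ?thesis using F(1) by (simp add: da_subspace_def)
  qed
  have iso1: "algebra_isomorphic (multiplier_algebra V ?S) (multiplier_algebra ?D ?W)"
    by (rule algebra_isomorphic_multiplier_algebra_reparam[OF V_D D_V f'_f S_on S_W W_on W_S])
  have iso2: "algebra_isomorphic (multiplier_algebra ?D ?W) (multiplier_algebra V ?S)"
    by (rule algebra_isomorphic_multiplier_algebra_reparam[OF D_V f'_f V_D W_on W_S S_on S_W])
  have "algebra_isomorphic (multiplier_algebra V ?S) H_infty
      \<longleftrightarrow> algebra_isomorphic (multiplier_algebra ?D ?W) H_infty"
    using algebra_isomorphic_trans[OF iso1] algebra_isomorphic_trans[OF iso2] by blast
  also have "\<dots> \<longleftrightarrow> (\<exists>\<delta>>0. \<forall>n. \<delta> \<le> c n)"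
  proof (rule weighted_hardy_multipliers_iso_iff)
    show "c m * c n \<le> c (m + n)" for m n
      unfolding c_def using renewal_bounds[OF a a0 a_sum] less_imp_le
      by (intro renewal_supermultiplicative a) auto
    show "\<exists>\<delta>>0. \<forall>n. \<delta> * r ^ n \<le> c n" if "0 < r" "r < 1" for r
      unfolding c_def by (rule renewal_subexponential[OF a a0 a_sums that])
    show "bounded (\<phi> ` ?D)" if "\<phi> \<in> multiplier_algebra ?D ?W" for \<phi>
      using that f'_f by (rule weighted_hardy_multiplier_bounded)
  qed (rule c_bounds)+
  also have "\<dots> \<longleftrightarrow> summable (\<lambda>n. real (n + 1) * a n)"
    unfolding c_def by (rule renewal_bounded_below_iff[OF a a0 a_sums])
  finally show ?thesis by (simp add: a_def)
qed

end
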